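(* Let $A$ be a finite set. For $n\ge 2$ and $x_1^n\in A^n$ define $$M_n^*(x_1^n)=\min\left\{k:\ \hat h_k(n)\le \frac{\log n}{\ell(n)}+2(\log n)^{-1/4}\right\},$$ where $\hat h_k(n)$ is the $k$-step conditional empirical entropy of $x_1^n$ and $\ell(n)$ is the length of the longest initial block of $x_1^n$ that repeats in $x_1^n$. Then $M_n^*$ is a consistent Markov order estimator; that is, for every $M\ge 0$ and every stationary ergodic $A$-valued process $X$ that is Markov of order $M$, $$\lim_{n\to\infty} M_n^*(X_1^n)=M\quad\text{almost surely}.$$
   Context: $A$ is a finite set, $x_m^n$ denotes the sequence $x_m,x_{m+1},\dots,x_n$ with $x_i\in A$, and $\log$ is the natural logarithm. A stationary, ergodic, $A$-valued process $X=\{X_n\}_{n\ge1}$ with distribution $\mathbf P$ is Markov of order $0$ if it is i.i.d.; it is Markov of order $M>0$ if it is not i.i.d. and $M$ is the least positive integer such that $\mathbf P(a_{k+1}|a_1^k)=\mathbf P(a_{k+1}|a_{k-M+1}^k)$ for all $k\ge M$ and all $a_1^{k+1}$ (with $\mathbf P(a_1^k)>0$). Here $\mathbf P(a_1^k)=\mathrm{Prob}(X_1^k=a_1^k)$ and $\mathbf P(a_{k+1}|a_1^k)$ is the corresponding conditional probability of the next symbol. Empirical counts (overlapping blocks): $N_n(a_1^k)=N_n(a_1^k|x_1^n)=|\{i\in[0,n-k]: x_{i+1}^{i+k}=a_1^k\}|$ (for the empty block, $k=0$, $N_{n-1}=n$). Empirical probabilities: $\hat P_n(a_1^{k+1})=\frac{1}{n-k}N_n(a_1^{k+1})$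 and $\hat P_n(a_{k+1}|a_1^k)=N_n(a_1^{k+1})/N_{n-1}(a_1^k)$. The $k$-step conditional empirical entropy is, for $0\le k<n$, $$\hat h_k(n)=-\sum_{a_1^{k+1}\in A^{k+1}}\hat P_n(a_1^{k+1})\log\hat P_n(a_{k+1}|a_1^k),$$ where terms with $\hat P_n(a_1^{k+1})=0$ are taken to be $0$. The minimum defining $M_n^*$ is over $0\le k<n$. $\ell(n)$ is the largest $k$ for which there is $r$ with $k\le r\le n-k$ and $x_{r+1}^{r+k}=x_1^k$. If $\ell(n)=0$, then $\frac{\log n}{\ell(n)}$ is read as $+\infty$ (almost surely this happens, for such $X$, for only finitely many $n$). *)

theory Defs
  imports "HOL-Probability.Probability"
begin

(* A word x_1, ..., x_n is a list of length n, with x_i = x ! (i - 1).  A process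
   X_1, X_2, ... is a family indexed from 0, with X_i given by X (i - 1). *)

definition count_block :: "'a list \<Rightarrow> 'a list \<Rightarrow> nat" where
  "count_block x a =
     card {i. i + length a \<le> length x \<and> take (length a) (drop i x) = a}"

(* For a block of length k + 1 the denominator is n - k. *)
definition emp_prob :: "'a list \<Rightarrow> 'a list \<Rightarrow> real" where
  "emp_prob x a = real (count_block x a) / (real (length x) + 1 - real (length a))"

(* N_{n-1} counts occurrences in x_1^{n-1}, hence the butlast. *)
definition emp_cond_prob :: "'a list \<Rightarrow> 'a list \<Rightarrow> 'a \<Rightarrow> real" where
  "emp_cond_prob x w b =
     real (count_block x (w @ [b])) / real (count_block (butlast x) w)"

(* Terms with emp_prob x a = 0 vanish because 0 * ln y = 0 for every y. *)
definition emp_entropy :: "'a set \<Rightarrow> nat \<Rightarrow> 'a list \<Rightarrow> real" where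
  "emp_entropy A k x =
     - (\<Sum>a | set a \<subseteq> A \<and> length a = k + 1.
          emp_prob x a * ln (emp_cond_prob x (butlast a) (last a)))"

(* The second occurrence of the initial block may not overlap the first. *)
definition repeat_length :: "'a list \<Rightarrow> nat" where
  "repeat_length x =
     Max {k. \<exists>r. k \<le> r \<and> r + k \<le> length x \<and> take k (drop r x) = take k x}"

definition entropy_threshold :: "'a list \<Rightarrow> ereal" where
  "entropy_threshold x =
     (if repeat_length x = 0 then \<infinity>
      else ereal (ln (real (length x)) / real (repeat_length x)
                  + 2 * ln (real (length x)) powr (- 1 / 4)))"

(* For length x \<ge> 2 such a k exists: emp_entropy A (length x - 1) x = 0 when
   set x \<subseteq> A. *)
definition order_estimate :: "'a set \<Rightarrow> 'a list \<Rightarrow> nat" where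
  "order_estimate A x =
     (LEAST k. k < length x \<and> ereal (emp_entropy A k x) \<le> entropy_threshold x)"

definition initial_word :: "(nat \<Rightarrow> 'w \<Rightarrow> 'a) \<Rightarrow> nat \<Rightarrow> 'w \<Rightarrow> 'a list" where
  "initial_word X n \<omega> = map (\<lambda>i. X i \<omega>) [0..<n]"

definition path_space :: "'a set \<Rightarrow> (nat \<Rightarrow> 'a) measure" where
  "path_space A = PiM UNIV (\<lambda>_. count_space A)"

definition stationary_process :: "'w measure \<Rightarrow> 'a set \<Rightarrow> (nat \<Rightarrow> 'w \<Rightarrow> 'a) \<Rightarrow> bool" where
  "stationary_process P A X \<longleftrightarrow>
     distr P (path_space A) (\<lambda>\<omega> i. X (Suc i) \<omega>) = distr P (path_space A) (\<lambda>\<omega> i. X i \<omega>)"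

definition ergodic_process :: "'w measure \<Rightarrow> 'a set \<Rightarrow> (nat \<Rightarrow> 'w \<Rightarrow> 'a) \<Rightarrow> bool" where
  "ergodic_process P A X \<longleftrightarrow>
     (\<forall>B \<in> sets (path_space A).
        (\<forall>s \<in> space (path_space A). (\<lambda>i. s (Suc i)) \<in> B \<longleftrightarrow> s \<in> B) \<longrightarrow>
        measure (distr P (path_space A) (\<lambda>\<omega> i. X i \<omega>)) B \<in> {0, 1})"

definition iid_process :: "'w measure \<Rightarrow> 'a set \<Rightarrow> (nat \<Rightarrow> 'w \<Rightarrow> 'a) \<Rightarrow> bool" where
  "iid_process P A X \<longleftrightarrow>
     prob_space.indep_vars P (\<lambda>_. count_space A) X UNIV \<and>
     (\<forall>i. distr P (count_space A) (X i) = distr P (count_space A) (X 0))"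

definition block_prob :: "'w measure \<Rightarrow> (nat \<Rightarrow> 'w \<Rightarrow> 'a) \<Rightarrow> 'a list \<Rightarrow> real" where
  "block_prob P X a = \<P>(\<omega> in P. initial_word X (length a) \<omega> = a)"

definition next_prob :: "'w measure \<Rightarrow> (nat \<Rightarrow> 'w \<Rightarrow> 'a) \<Rightarrow> 'a list \<Rightarrow> 'a \<Rightarrow> real" where
  "next_prob P X w b =
     \<P>(\<omega> in P. X (length w) \<omega> = b \<bar> initial_word X (length w) \<omega> = w)"

(* drop (length w - m) w consists of the last m letters of w.  Its conditional
   probabilities are taken at time 0, which is the intended meaning for a
   stationary process. *)
definition memory_at_most :: "'w measure \<Rightarrow> 'a set \<Rightarrow> (nat \<Rightarrow> 'w \<Rightarrow> 'a) \<Rightarrow> nat \<Rightarrow> bool" where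
  "memory_at_most P A X m \<longleftrightarrow>
     (\<forall>w b. set w \<subseteq> A \<longrightarrow> b \<in> A \<longrightarrow> m \<le> length w \<longrightarrow> block_prob P X w > 0 \<longrightarrow>
        next_prob P X w b = next_prob P X (drop (length w - m) w) b)"

definition markov_of_order :: "'w measure \<Rightarrow> 'a set \<Rightarrow> (nat \<Rightarrow> 'w \<Rightarrow> 'a) \<Rightarrow> nat \<Rightarrow> bool" where
  "markov_of_order P A X m \<longleftrightarrow>
     (if m = 0 then iid_process P A X
      else \<not> iid_process P A X \<and> memory_at_most P A X m \<and>
           (\<forall>m'. 0 < m' \<and> m' < m \<longrightarrow> \<not> memory_at_most P A X m'))"

end

theory Submission
  imports Defs "HOL-Real_Asymp.Real_Asymp" "Jordan_Normal_Form.Determinant"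
begin

text \<open>Let \<open>h\<^sub>k = H(X\<^sub>k | X\<^sub>0, \<dots>, X\<^bsub>k-1\<^esub>)\<close>; the entropy rate is \<open>h = h\<^sub>M\<close>, and \<open>h\<^sub>k > h\<close> for \<open>k < M\<close> by the equality
  case of Gibbs' inequality. The empirical entropies converge to \<open>h\<^sub>k\<close>, so it suffices that the threshold
  tends to \<open>h\<close> while eventually staying above the empirical entropy of order \<open>M\<close>.

  All rates come from sums \<open>\<Sum>i<n. f (X\<^sub>i, \<dots>, X\<^bsub>i+L-1\<^esub>)\<close> over blocks. Ergodicity makes \<open>1\<close> a simple eigenvalue of
  the transition matrix on blocks, so Poisson's equation is solvable and such a sum is its mean plus a martingale
  with bounded increments plus a bounded term. Its variance is \<open>O(n)\<close>, and Borel-Cantelli along cubes gives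
  deviations \<open>o(n\<^sup>3\<^sup>/\<^sup>4)\<close>. In particular \<open>- ln P(X\<^sub>1, \<dots>, X\<^sub>k) = k h + o(k\<^sup>3\<^sup>/\<^sup>4)\<close>, and since the empirical
  transition probabilities maximise the likelihood, the empirical entropy of order \<open>M\<close> is at most
  \<open>h + O(n powr (-1/4))\<close>.

  By the Markov property, the initial block of length \<open>k\<close> recurs at a given time \<open>r \<ge> k\<close> with conditional
  probability at most \<open>C P(X\<^sub>1, \<dots>, X\<^sub>k)\<close>, so it does not recur before time \<open>exp (k h - \<delta> k\<^sup>3\<^sup>/\<^sup>4)\<close>. This bounds
  the threshold from below. Conversely, by stationarity a given block of length \<open>k\<close> occurs at time 0 without
  recurring between times \<open>k\<close> and \<open>N\<close> with probability at most \<open>k / N\<close>. Summing over the at most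
  \<open>exp (k (h + \<epsilon>))\<close> typical blocks bounds the threshold from above by \<open>h + o(1)\<close>.\<close>

section \<open>Linear systems\<close>

unbundle no vec_syntax

text \<open>A square matrix with trivial kernel is invertible: \<open>det B = 0\<close> would yield
  a nonzero kernel vector. The enumeration \<open>e\<close> of \<open>S\<close> carries the system
  to matrices indexed by numbers, and \<open>e'\<close> carries the solution back.\<close>

lemma injective_system_solvable:
  fixes a :: "'b \<Rightarrow> 'b \<Rightarrow> real"
  assumes "finite S"
    and inj: "\<And>g. (\<And>x. x \<in> S \<Longrightarrow> (\<Sum>y\<in>S. a x y * g y) = 0) \<Longrightarrow> (\<And>y. y \<in> S \<Longrightarrow> g y = 0)"
  obtains g where "\<And>x. x \<in> S \<Longrightarrow> (\<Sum>y\<in>S. a x y * g y) = f x"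
proof -
  define n where "n = card S"
  obtain e where e: "bij_betw e {0..<n} S"
    using ex_bij_betw_nat_finite[OF assms(1)] unfolding n_def by blast
  define e' where "e' = the_inv_into {0..<n} e"
  have e'e: "e' (e i) = i" if "i < n" for i
    using that e unfolding e'_def bij_betw_def by (auto intro: the_inv_into_f_f)
  have eS: "e i \<in> S" if "i < n" for i using that e by (auto simp: bij_betw_def)
  have exS: "\<exists>i<n. x = e i" if "x \<in> S" for x
    using that e by (auto simp: bij_betw_def)
  define B where "B = mat n n (\<lambda>(i,j). a (e i) (e j))"
  have B: "B \<in> carrier_mat n n" unfolding B_def by simp
  have sumS: "(\<Sum>y\<in>S. F y) = (\<Sum>j=0..<n. F (e j))" for F :: "'b \<Rightarrow> real"
    using sum.reindex_bij_betw[OF e, of F] by simp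
  have mv: "(B *\<^sub>v v) $ i = (\<Sum>j=0..<n. a (e i) (e j) * v $ j)"
    if "v \<in> carrier_vec n" "i < n" for v i
    using that by (auto simp: B_def scalar_prod_def)
  have "det B \<noteq> 0"
  proof
    assume "det B = 0"
    then obtain v where v: "v \<in> carrier_vec n" "v \<noteq> 0\<^sub>v n" "B *\<^sub>v v = 0\<^sub>v n"
      using det_0_iff_vec_prod_zero[OF B] by blast
    have "v $ e' y = 0" if "y \<in> S" for y
    proof (rule inj[OF _ that])
      fix x assume "x \<in> S"
      then obtain i where i: "i < n" "x = e i" using exS by blast
      have "(\<Sum>y\<in>S. a x y * v $ e' y) = (\<Sum>j=0..<n. a (e i) (e j) * v $ j)"
        unfolding sumS i(2) by (rule sum.cong) (auto simp: e'e)
      also have "\<dots> = 0" using mv[OF v(1) i(1)] v(3) i(1) by simp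
      finally show "(\<Sum>y\<in>S. a x y * v $ e' y) = 0" .
    qed
    then have "v $ i = 0" if "i < n" for i using eS[OF that] e'e[OF that] by metis
    then have "v = 0\<^sub>v n" using v(1) by (intro eq_vecI) auto
    then show False using v(2) by simp
  qed
  then have "B \<in> Units (ring_mat TYPE(real) n ())" by (rule det_non_zero_imp_unit[OF B])
  then obtain B' where B': "B' \<in> carrier_mat n n" "B * B' = 1\<^sub>m n"
    unfolding Units_def ring_mat_def by auto
  define v where "v = B' *\<^sub>v vec n (\<lambda>i. f (e i))"
  have v: "v \<in> carrier_vec n" unfolding v_def using B'(1) by simp
  have "B *\<^sub>v v = vec n (\<lambda>i. f (e i))"
    unfolding v_def using B B' by (subst assoc_mult_mat_vec[symmetric, of _ n n _ n]) auto
  then have Bv: "(\<Sum>j=0..<n. a (e i) (e j) * v $ j) = f (e i)" if "i < n" for i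
    using mv[OF v that] that by simp
  have "(\<Sum>y\<in>S. a x y * v $ e' y) = f x" if "x \<in> S" for x
  proof -
    obtain i where i: "i < n" "x = e i" using exS[OF \<open>x \<in> S\<close>] by blast
    have "(\<Sum>y\<in>S. a x y * v $ e' y) = (\<Sum>j=0..<n. a (e i) (e j) * v $ j)"
      unfolding sumS i(2) by (rule sum.cong) (auto simp: e'e)
    then show ?thesis using Bv[OF i(1)] i(2) by simp
  qed
  then show ?thesis by (rule that)
qed

section \<open>Stationary laws on words\<close>

definition words :: "'a set \<Rightarrow> nat \<Rightarrow> 'a list set" where
  "words A n = {w. set w \<subseteq> A \<and> length w = n}"

lemma in_words [simp]: "w \<in> words A n \<longleftrightarrow> set w \<subseteq> A \<and> length w = n"
  by (simp add: words_def)

lemma words_0 [simp]: "words A 0 = {[]}"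
  by (auto simp: words_def)

lemma finite_words: "finite A \<Longrightarrow> finite (words A n)"
  unfolding words_def by (rule finite_lists_length_eq)

lemma sum_words_append:
  "(\<Sum>w\<in>words A (m + n). F w) = (\<Sum>u\<in>words A m. \<Sum>v\<in>words A n. F (u @ v))"
  unfolding sum.cartesian_product
  by (rule sum.reindex_bij_witness[where i = "\<lambda>(u, v). u @ v" and j = "\<lambda>w. (take m w, drop m w)"])
    (auto dest: in_set_takeD in_set_dropD)

lemma sum_words_1: "(\<Sum>w\<in>words A 1. F w) = (\<Sum>b\<in>A. F [b])"
  by (rule sum.reindex_bij_witness[where i = "\<lambda>b. [b]" and j = hd]) (auto simp: length_Suc_conv)

lemma sum_words_snoc:
  "(\<Sum>w\<in>words A (Suc n). F w) = (\<Sum>w\<in>words A n. \<Sum>b\<in>A. F (w @ [b]))"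
  using sum_words_append[where m = n and n = 1 and F = F] by (simp only: sum_words_1 Suc_eq_plus1)

text \<open>The finite-dimensional laws of a process, where \<open>p w\<close> is the probability
  that the path starts with \<open>w\<close>. Consistency under \<open>sum_p_snoc\<close> makes them
  marginals of one process, and \<open>sum_p_Cons\<close> expresses stationarity.\<close>

locale word_law =
  fixes A :: "'a set" and p :: "'a list \<Rightarrow> real"
  assumes finite_A: "finite A"
    and p_nonneg: "0 \<le> p w"
    and p_Nil: "p [] = 1"
    and sum_p_snoc: "set w \<subseteq> A \<Longrightarrow> (\<Sum>b\<in>A. p (w @ [b])) = p w"
    and sum_p_Cons: "set w \<subseteq> A \<Longrightarrow> (\<Sum>a\<in>A. p (a # w)) = p w"
begin

lemma finite_words_A [simp]: "finite (words A n)"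
  by (rule finite_words[OF finite_A])

lemma sum_p_append_right: "set u \<subseteq> A \<Longrightarrow> (\<Sum>v\<in>words A n. p (u @ v)) = p u"
proof (induction n)
  case (Suc n)
  have "(\<Sum>v\<in>words A (Suc n). p (u @ v)) = (\<Sum>v\<in>words A n. \<Sum>b\<in>A. p ((u @ v) @ [b]))"
    by (simp add: sum_words_snoc)
  also have "\<dots> = (\<Sum>v\<in>words A n. p (u @ v))"
    by (intro sum.cong refl sum_p_snoc) (use Suc.prems in auto)
  finally show ?case using Suc by simp
qed simp

lemma sum_p_append_left: "set v \<subseteq> A \<Longrightarrow> (\<Sum>u\<in>words A n. p (u @ v)) = p v"
proof (induction n)
  case (Suc n)
  have "(\<Sum>u\<in>words A (1 + n). p (u @ v)) = (\<Sum>a\<in>words A 1. \<Sum>u\<in>words A n. p (a @ u @ v))"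
    unfolding sum_words_append by simp
  also have "\<dots> = (\<Sum>u\<in>words A n. \<Sum>a\<in>A. p (a # u @ v))"
    by (subst sum.swap) (simp only: sum_words_1 append_Cons append_Nil)
  also have "\<dots> = (\<Sum>u\<in>words A n. p (u @ v))"
    by (intro sum.cong refl sum_p_Cons) (use Suc.prems in auto)
  finally show ?case using Suc by simp
qed simp

lemma p_append_le_left: "set u \<subseteq> A \<Longrightarrow> set v \<subseteq> A \<Longrightarrow> p (u @ v) \<le> p u"
  using sum_p_append_right[of u "length v"]
    member_le_sum[of v "words A (length v)" "\<lambda>v. p (u @ v)"] p_nonneg by auto

lemma p_append_le_right: "set u \<subseteq> A \<Longrightarrow> set v \<subseteq> A \<Longrightarrow> p (u @ v) \<le> p v"
  using sum_p_append_left[of v "length u"]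
    member_le_sum[of u "words A (length u)" "\<lambda>u. p (u @ v)"] p_nonneg by auto

lemma p_take_pos:
  assumes "set w \<subseteq> A" "0 < p w"
  shows "0 < p (take n w)"
proof -
  have "p (take n w @ drop n w) \<le> p (take n w)"
    using assms(1) set_take_subset[of n w] set_drop_subset[of n w] by (intro p_append_le_left) auto
  then show ?thesis using assms(2) by simp
qed

lemma p_drop_pos:
  assumes "set w \<subseteq> A" "0 < p w"
  shows "0 < p (drop n w)"
proof -
  have "p (take n w @ drop n w) \<le> p (drop n w)"
    using assms(1) set_take_subset[of n w] set_drop_subset[of n w] by (intro p_append_le_right) auto
  then show ?thesis using assms(2) by simp
qed

lemma sum_p_words: "(\<Sum>w\<in>words A n. p w) = 1"
  using sum_p_append_right[of "[]" n] p_Nil by simp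

text \<open>The expectation of \<open>F\<close> of the first \<open>n\<close> letters, kept as a
  finite sum so that moment estimates need no integrals.\<close>

definition ex :: "nat \<Rightarrow> ('a list \<Rightarrow> real) \<Rightarrow> real" where
  "ex n F = (\<Sum>w\<in>words A n. p w * F w)"

lemma ex_take: "ex (m + n) (\<lambda>w. F (take m w)) = ex m F"
  unfolding ex_def sum_words_append
  by (rule sum.cong[OF refl]) (simp add: sum_distrib_right[symmetric] sum_p_append_right)

lemma ex_drop: "ex (m + n) (\<lambda>w. F (drop m w)) = ex n F"
  unfolding ex_def sum_words_append
  by (subst sum.swap, rule sum.cong[OF refl]) (simp add: sum_distrib_right[symmetric] sum_p_append_left)

lemma ex_add: "ex n (\<lambda>w. F w + G w) = ex n F + ex n G"
  by (simp add: ex_def distrib_left sum.distrib)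

lemma ex_cmult: "ex n (\<lambda>w. c * F w) = c * ex n F"
  by (simp add: ex_def sum_distrib_left mult.left_commute)

lemma ex_const: "ex n (\<lambda>w. c) = c"
  by (simp add: ex_def sum_distrib_right[symmetric] sum_p_words)

lemma ex_diff: "ex n (\<lambda>w. F w - G w) = ex n F - ex n G"
  by (simp add: ex_def right_diff_distrib sum_subtractf)

text \<open>Null words carry weight 0, so the comparison may assume \<open>0 < p w\<close>;
  conditional probabilities and logarithms are then well behaved.\<close>

lemma ex_mono:
  assumes "\<And>w. set w \<subseteq> A \<Longrightarrow> length w = n \<Longrightarrow> 0 < p w \<Longrightarrow> F w \<le> G w"
  shows "ex n F \<le> ex n G"
  unfolding ex_def
proof (rule sum_mono)
  fix w assume "w \<in> words A n"
  then show "p w * F w \<le> p w * G w"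
    using assms[of w] p_nonneg[of w] by (cases "p w = 0") (auto intro: mult_left_mono)
qed

lemma ex_cong:
  assumes "\<And>w. set w \<subseteq> A \<Longrightarrow> length w = n \<Longrightarrow> 0 < p w \<Longrightarrow> F w = G w"
  shows "ex n F = ex n G"
  using ex_mono[of n F G] ex_mono[of n G F] assms by (simp add: antisym)

lemma ex_sum: "ex n (\<lambda>w. \<Sum>i\<in>I. F i w) = (\<Sum>i\<in>I. ex n (F i))"
  unfolding ex_def by (subst sum.swap) (simp add: sum_distrib_left)

section \<open>Conditional probabilities and the transition operator on blocks\<close>

definition nx :: "'a list \<Rightarrow> 'a \<Rightarrow> real" where
  "nx w b = p (w @ [b]) / p w"

lemma nx_nonneg: "0 \<le> nx w b"
  by (simp add: nx_def p_nonneg)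

text \<open>This also covers \<open>p w = 0\<close>, where the quotient in \<open>nx\<close> is 0 by
  convention: monotonicity makes \<open>p (w @ [b])\<close> vanish as well.\<close>

lemma p_mult_nx: "set w \<subseteq> A \<Longrightarrow> b \<in> A \<Longrightarrow> p w * nx w b = p (w @ [b])"
  using p_append_le_left[of w "[b]"] p_nonneg[of "w @ [b]"] by (auto simp: nx_def)

lemma sum_nx: "set w \<subseteq> A \<Longrightarrow> 0 < p w \<Longrightarrow> (\<Sum>b\<in>A. nx w b) = 1"
  by (simp add: nx_def sum_divide_distrib[symmetric] sum_p_snoc)

text \<open>The transition operator of the chain of overlapping blocks: from the block
  \<open>y\<close> the chain moves to \<open>tl (y @ [b])\<close>. For blocks of length 0 the only
  state is \<open>[]\<close>.\<close>

definition step :: "('a list \<Rightarrow> real) \<Rightarrow> 'a list \<Rightarrow> real" where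
  "step g y = (\<Sum>b\<in>A. nx y b * g (tl (y @ [b])))"

text \<open>The tower property for two successive blocks \<open>butlast u\<close> and
  \<open>tl u\<close> of one longer word: \<open>step g\<close> is the conditional expectation of
  \<open>g\<close> at the second block given the first.\<close>

lemma ex_mult_step:
  "ex L (\<lambda>y. H y * step g y) = ex (Suc L) (\<lambda>u. H (butlast u) * g (tl u))"
proof -
  have "p y * (H y * step g y) = (\<Sum>b\<in>A. p (y @ [b]) * (H y * g (tl (y @ [b]))))"
    if "y \<in> words A L" for y
  proof -
    have "p y * (H y * step g y) = (\<Sum>b\<in>A. (p y * nx y b) * (H y * g (tl (y @ [b]))))"
      unfolding step_def sum_distrib_left by (intro sum.cong) (auto simp: algebra_simps)
    also have "\<dots> = (\<Sum>b\<in>A. p (y @ [b]) * (H y * g (tl (y @ [b]))))"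
      using that by (intro sum.cong) (auto simp: p_mult_nx)
    finally show ?thesis .
  qed
  then show ?thesis unfolding ex_def sum_words_snoc by simp
qed

lemma ex_butlast: "ex (Suc L) (\<lambda>u. F (butlast u)) = ex L F"
  using ex_take[of L 1 F] unfolding ex_def
  by (simp add: butlast_conv_take)

lemma ex_tl: "ex (Suc L) (\<lambda>u. F (tl u)) = ex L F"
  using ex_drop[of 1 L F] by (simp add: drop_Suc)

end

text \<open>Ergodicity appears in a combinatorial form: a function on blocks that is unchanged along
  every transition of positive probability is constant on the blocks of positive
  probability.\<close>

locale markov_law = word_law +
  fixes M :: nat
  assumes memory: "set w \<subseteq> A \<Longrightarrow> b \<in> A \<Longrightarrow> M \<le> length w \<Longrightarrow> 0 < p w \<Longrightarrow>
      nx w b = nx (drop (length w - M) w) b"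
    and ergodic: "(\<And>u. set u \<subseteq> A \<Longrightarrow> length u = Suc L \<Longrightarrow> 0 < p u \<Longrightarrow> g (tl u) = (g (butlast u) :: real)) \<Longrightarrow>
      set y \<subseteq> A \<Longrightarrow> length y = L \<Longrightarrow> 0 < p y \<Longrightarrow> set z \<subseteq> A \<Longrightarrow> length z = L \<Longrightarrow> 0 < p z \<Longrightarrow> g y = g z"
begin

lemma memory_append:
  assumes "set (u @ w) \<subseteq> A" "b \<in> A" "M \<le> length w" "0 < p (u @ w)"
  shows "nx (u @ w) b = nx w b"
proof -
  have "0 < p w"
    using p_append_le_right[of u w] assms by auto
  then have "nx w b = nx (drop (length w - M) w) b"
    using assms by (intro memory) auto
  moreover have "nx (u @ w) b = nx (drop (length (u @ w) - M) (u @ w)) b"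
    using assms by (intro memory) auto
  moreover have "drop (length (u @ w) - M) (u @ w) = drop (length w - M) w"
    using assms(3) by simp
  ultimately show ?thesis by simp
qed

text \<open>Past \<open>u\<close> and future \<open>z\<close> are independent given the
  \<open>M\<close> letters \<open>v\<close> between them. The product form avoids dividing by
  \<open>p v\<close>; the future is built up letter by letter.\<close>

lemma p_chain:
  assumes "length v = M" "set (u @ v @ z) \<subseteq> A"
  shows "p (u @ v @ z) * p v = p (u @ v) * p (v @ z)"
  using assms(2)
proof (induction z rule: rev_induct)
  case (snoc b z)
  have IH: "p (u @ v @ z) * p v = p (u @ v) * p (v @ z)" using snoc by simp
  have 1: "p (u @ v @ z @ [b]) = p (u @ v @ z) * nx (u @ v @ z) b"
    using p_mult_nx[of "u @ v @ z" b] snoc.prems by simp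
  have 2: "p (v @ z @ [b]) = p (v @ z) * nx (v @ z) b"
    using p_mult_nx[of "v @ z" b] snoc.prems by simp
  show ?case
  proof (cases "p (u @ v @ z) = 0")
    case True
    then show ?thesis using IH 1 2 by auto
  next
    case False
    then have "nx (u @ v @ z) b = nx (v @ z) b"
      using memory_append[of u "v @ z" b] snoc.prems assms(1) p_nonneg[of "u @ v @ z"] by simp
    then show ?thesis using 1 2 IH by (metis mult.assoc mult.commute)
  qed
qed simp

text \<open>For \<open>step g = g\<close>, the mean of the squared increment of \<open>g\<close>
  over one transition is twice the mean of \<open>g\<close> squared minus twice the mean of
  \<open>g\<close> times \<open>step g\<close>, hence 0. So \<open>g\<close> is unchanged along each
  possible transition, and ergodicity applies.\<close>

lemma stationary_constant:
  assumes "\<And>y. set y \<subseteq> A \<Longrightarrow> length y = L \<Longrightarrow> 0 < p y \<Longrightarrow> step g y = g y"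
    and "set y \<subseteq> A" "length y = L" "0 < p y" "set z \<subseteq> A" "length z = L" "0 < p z"
  shows "g y = g z"
proof (rule ergodic[OF _ assms(2-)])
  fix u assume u: "set u \<subseteq> A" "length u = Suc L" "0 < p u"
  have "ex (Suc L) (\<lambda>u. (g (tl u) - g (butlast u))\<^sup>2)
      = ex (Suc L) (\<lambda>u. (g (tl u))\<^sup>2 + (g (butlast u))\<^sup>2 - 2 * (g (butlast u) * g (tl u)))"
    by (simp add: power2_diff algebra_simps)
  also have "\<dots> = ex L (\<lambda>u. (g u)\<^sup>2) + ex L (\<lambda>u. (g u)\<^sup>2) - 2 * ex L (\<lambda>y. g y * step g y)"
    by (simp add: ex_diff ex_add ex_cmult ex_mult_step ex_tl[where F = "\<lambda>u. (g u)\<^sup>2"]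
        ex_butlast[where F = "\<lambda>u. (g u)\<^sup>2"])
  also have "ex L (\<lambda>y. g y * step g y) = ex L (\<lambda>u. (g u)\<^sup>2)"
    by (rule ex_cong) (simp add: assms(1) power2_eq_square)
  finally have "(\<Sum>u\<in>words A (Suc L). p u * (g (tl u) - g (butlast u))\<^sup>2) = 0"
    by (simp add: ex_def)
  then have "\<forall>u\<in>words A (Suc L). p u * (g (tl u) - g (butlast u))\<^sup>2 = 0"
    by (subst (asm) sum_nonneg_eq_0_iff) (auto simp: p_nonneg simp del: in_words)
  from bspec[OF this, of u] have "p u * (g (tl u) - g (butlast u))\<^sup>2 = 0" using u by simp
  then show "g (tl u) = g (butlast u)" using u by simp
qed

text \<open>The matrix \<open>a\<close> is \<open>I - Q + 1 \<pi>\<close> for the chain of \<open>L\<close>-blocks, whose inverse is the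
  fundamental matrix.\<close>

lemma poisson_equation:
  obtains g where "\<And>y. set y \<subseteq> A \<Longrightarrow> length y = L \<Longrightarrow> 0 < p y \<Longrightarrow> g y - step g y = f y - ex L f"
proof -
  define S where "S = {y \<in> words A L. 0 < p y}"
  have "S \<subseteq> words A L" by (auto simp: S_def)
  from finite_subset[OF this finite_words_A] this have S: "finite S" "S \<subseteq> words A L" .
  have ex_S: "(\<Sum>z\<in>S. p z * g z) = ex L g" for g
    unfolding ex_def using S p_nonneg
    by (intro sum.mono_neutral_left) (auto simp: S_def order.order_iff_strict)
  define a where "a y z = of_bool (y = z) - (\<Sum>b\<in>A. of_bool (tl (y @ [b]) = z) * nx y b) + p z" for y z
  have a: "(\<Sum>z\<in>S. a y z * g z) = g y - step g y + ex L g" if "y \<in> S" for y g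
  proof -
    have y: "set y \<subseteq> A" "length y = L" "0 < p y" using that by (auto simp: S_def)
    have "(\<Sum>z\<in>S. (\<Sum>b\<in>A. of_bool (tl (y @ [b]) = z) * nx y b) * g z)
        = (\<Sum>b\<in>A. \<Sum>z\<in>S. of_bool (tl (y @ [b]) = z) * (nx y b * g z))"
      unfolding sum_distrib_right by (subst sum.swap) (simp add: mult.assoc)
    also have "\<dots> = (\<Sum>b\<in>A. nx y b * g (tl (y @ [b])))"
    proof (rule sum.cong[OF refl])
      fix b assume b: "b \<in> A"
      have "(\<Sum>z\<in>S. of_bool (tl (y @ [b]) = z) * (nx y b * g z))
          = (\<Sum>z\<in>S. if tl (y @ [b]) = z then nx y b * g z else 0)"
        by (rule sum.cong) auto
      also have "\<dots> = (if tl (y @ [b]) \<in> S then nx y b * g (tl (y @ [b])) else 0)"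
        using S(1) by (simp add: sum.delta')
      \<comment> \<open>Restricting the state space to \<open>S\<close> loses nothing: a transition
        into a null block has probability 0.\<close>
      also have "\<dots> = nx y b * g (tl (y @ [b]))"
      proof (cases "tl (y @ [b]) \<in> S")
        case False
        moreover have "tl (y @ [b]) \<in> words A L"
          using y b by (cases y) auto
        ultimately have "p (tl (y @ [b])) = 0"
          using p_nonneg[of "tl (y @ [b])"] by (auto simp: S_def)
        moreover obtain c v where cv: "y @ [b] = c # v" by (cases "y @ [b]") auto
        moreover have "set (c # v) \<subseteq> A" unfolding cv[symmetric] using y b by auto
        ultimately have "p (y @ [b]) = 0"
          using p_append_le_right[of "[c]" v] p_nonneg[of "y @ [b]"] by simp
        then show ?thesis by (simp add: nx_def)
      qed simp
      finally show "(\<Sum>z\<in>S. of_bool (tl (y @ [b]) = z) * (nx y b * g z)) = nx y b * g (tl (y @ [b]))" .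
    qed
    finally have step: "(\<Sum>z\<in>S. (\<Sum>b\<in>A. of_bool (tl (y @ [b]) = z) * nx y b) * g z) = step g y"
      by (simp add: step_def)
    have "(\<Sum>z\<in>S. of_bool (y = z) * g z) = (\<Sum>z\<in>S. if y = z then g z else 0)"
      by (rule sum.cong) auto
    then have "(\<Sum>z\<in>S. of_bool (y = z) * g z) = g y"
      using S(1) that by (simp add: sum.delta')
    moreover have "(\<Sum>z\<in>S. a y z * g z) = (\<Sum>z\<in>S. of_bool (y = z) * g z)
        - (\<Sum>z\<in>S. (\<Sum>b\<in>A. of_bool (tl (y @ [b]) = z) * nx y b) * g z) + (\<Sum>z\<in>S. p z * g z)"
      unfolding a_def by (simp only: distrib_right left_diff_distrib sum.distrib sum_subtractf)
    ultimately show ?thesis by (simp only: step ex_S)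
  qed
  have ex_step: "ex L (step g) = ex L g" for g
    using ex_mult_step[of L "\<lambda>_. 1" g] by (simp add: ex_tl)
  show ?thesis
  proof (rule injective_system_solvable[OF S(1), of a f])
    fix g y assume 0: "\<And>x. x \<in> S \<Longrightarrow> (\<Sum>y\<in>S. a x y * g y) = 0" and y: "y \<in> S"
    have *: "g x - step g x + ex L g = 0" if "x \<in> S" for x using 0[OF that] a[OF that] by simp
    \<comment> \<open>Averaging against \<open>p\<close> cancels \<open>g - step g\<close> by
      stationarity and leaves \<open>ex L g = 0\<close>. Then \<open>g\<close> is harmonic, hence
      constant with mean 0.\<close>
    have "0 = ex L (\<lambda>x. g x - step g x + ex L g)"
      using ex_const[of L 0] by (subst ex_const[of L 0, symmetric], intro ex_cong) (auto simp: * S_def)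
    also have "\<dots> = ex L g" by (simp add: ex_add ex_diff ex_step ex_const)
    finally have 1: "ex L g = 0" by simp
    have "ex L g = ex L (\<lambda>_. g y)"
    proof (rule ex_cong)
      fix w assume "set w \<subseteq> A" "length w = L" "0 < p w"
      then show "g w = g y"
        using y * 1 by (intro stationary_constant[of L g]) (auto simp: S_def)
    qed
    then show "g y = 0" using 1 by (simp add: ex_const)
  next
    fix g assume g: "\<And>x. x \<in> S \<Longrightarrow> (\<Sum>y\<in>S. a x y * g y) = f x"
    have *: "g x - step g x + ex L g = f x" if "x \<in> S" for x using g[OF that] a[OF that] by simp
    \<comment> \<open>The same averaging shows that the constant \<open>ex L g\<close> in the solved
      system is \<open>ex L f\<close>.\<close>
    have "ex L f = ex L (\<lambda>x. g x - step g x + ex L g)"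
      by (rule ex_cong) (auto simp: * S_def)
    also have "\<dots> = ex L g" by (simp add: ex_add ex_diff ex_step ex_const)
    finally have "ex L f = ex L g" .
    then show ?thesis
      using * that[of g] unfolding S_def by (auto simp: algebra_simps)
  qed
qed

section \<open>Second moments of block sums\<close>

text \<open>The increments have conditional mean 0 given the past, so the cross term vanishes and
  each step adds at most \<open>D\<close> squared to the second moment.\<close>

lemma martingale_second_moment:
  assumes L: "M \<le> L"
    and D: "\<And>y z. y \<in> words A L \<Longrightarrow> z \<in> words A L \<Longrightarrow> \<bar>g z - step g y\<bar> \<le> D"
  defines "T \<equiv> \<lambda>n u. \<Sum>i<n. g (take L (drop (Suc i) u)) - step g (take L (drop i u))"
  shows "ex (n + L) (\<lambda>u. (T n u)\<^sup>2) \<le> real n * D\<^sup>2"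
proof (induction n)
  case 0
  show ?case by (simp add: T_def ex_const)
next
  case (Suc n)
  define d where "d u b = g (tl (drop n u @ [b])) - step g (drop n u)" for u b
  have T_snoc: "T (Suc n) (u @ [b]) = T n u + d u b" if "length u = n + L" for u b
  proof -
    have "T n (u @ [b]) = T n u"
      unfolding T_def using that by (intro sum.cong) auto
    moreover have "take L (drop (Suc n) (u @ [b])) = tl (drop n u @ [b])"
      using that by (cases "L = 0") (auto simp: drop_Suc tl_drop[symmetric] tl_append split: list.split)
    moreover have "take L (drop n (u @ [b])) = drop n u" using that by simp
    ultimately show ?thesis by (simp add: T_def d_def)
  qed
  have "(\<Sum>b\<in>A. p (u @ [b]) * (T (Suc n) (u @ [b]))\<^sup>2) \<le> p u * (T n u)\<^sup>2 + p u * D\<^sup>2"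
    if u: "u \<in> words A (n + L)" for u
  proof (cases "p u = 0")
    case True
    then have "p (u @ [b]) = 0" if "b \<in> A" for b
      using p_append_le_left[of u "[b]"] u that p_nonneg[of "u @ [b]"] by simp
    then show ?thesis using True by simp
  next
    case False
    then have pu: "0 < p u" using p_nonneg[of u] by simp
    have du: "set (drop n u) \<subseteq> A" "length (drop n u) = L" "0 < p (drop n u)"
      using u pu p_drop_pos[of u n] set_drop_subset[of n u] by auto
    \<comment> \<open>Here \<open>M \<le> L\<close> matters: given the whole past \<open>u\<close>,
      the next letter depends only on the last block, which is what \<open>step g\<close> conditions
      on.\<close>
    have nx: "nx u b = nx (drop n u) b" if "b \<in> A" for b
      using memory_append[of "take n u" "drop n u" b] that u du pu L by simp
    have "(\<Sum>b\<in>A. nx u b * d u b) = (\<Sum>b\<in>A. nx (drop n u) b * g (tl (drop n u @ [b])))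
        - (\<Sum>b\<in>A. nx (drop n u) b) * step g (drop n u)"
      unfolding d_def by (simp add: nx right_diff_distrib sum_subtractf sum_distrib_right)
    also have "\<dots> = 0" using sum_nx[OF du(1,3)] by (simp add: step_def)
    finally have mean0: "(\<Sum>b\<in>A. nx u b * d u b) = 0" .
    have d_le: "(d u b)\<^sup>2 \<le> D\<^sup>2" if "b \<in> A" for b
    proof -
      have "tl (drop n u @ [b]) \<in> words A L" using du that by (cases "drop n u") auto
      then have "\<bar>d u b\<bar> \<le> D" unfolding d_def using du by (intro D) auto
      then show ?thesis by (rule power2_le_iff_abs_le[THEN iffD2, rotated]) (use \<open>\<bar>d u b\<bar> \<le> D\<close> in linarith)
    qed
    have "(\<Sum>b\<in>A. p (u @ [b]) * (T (Suc n) (u @ [b]))\<^sup>2) = (\<Sum>b\<in>A. p u * nx u b * (T n u + d u b)\<^sup>2)"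
      using u by (intro sum.cong) (auto simp: p_mult_nx T_snoc)
    also have "\<dots> = p u * ((\<Sum>b\<in>A. nx u b) * (T n u)\<^sup>2 + 2 * T n u * (\<Sum>b\<in>A. nx u b * d u b)
        + (\<Sum>b\<in>A. nx u b * (d u b)\<^sup>2))"
      by (simp add: power2_sum algebra_simps sum.distrib sum_distrib_left sum_distrib_right)
    also have "\<dots> = p u * (T n u)\<^sup>2 + p u * (\<Sum>b\<in>A. nx u b * (d u b)\<^sup>2)"
      using mean0 sum_nx[of u] u pu by (simp add: algebra_simps)
    also have "(\<Sum>b\<in>A. nx u b * (d u b)\<^sup>2) \<le> (\<Sum>b\<in>A. nx u b * D\<^sup>2)"
      by (intro sum_mono mult_left_mono d_le nx_nonneg)
    also have "\<dots> = D\<^sup>2" using sum_nx[of u] u pu by (simp add: sum_distrib_right[symmetric])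
    finally show ?thesis using pu by simp
  qed
  then have "ex (Suc n + L) (\<lambda>u. (T (Suc n) u)\<^sup>2) \<le> (\<Sum>u\<in>words A (n + L). p u * (T n u)\<^sup>2 + p u * D\<^sup>2)"
    unfolding ex_def add_Suc sum_words_snoc by (rule sum_mono)
  also have "\<dots> = ex (n + L) (\<lambda>u. (T n u)\<^sup>2) + D\<^sup>2"
    by (simp add: sum.distrib sum_distrib_right[symmetric] sum_p_words ex_def)
  also have "\<dots> \<le> real (Suc n) * D\<^sup>2" using Suc by (simp add: algebra_simps)
  finally show ?case .
qed

text \<open>Poisson's equation splits the centred sum into the martingale \<open>T n\<close> and a
  telescoping term, the difference of \<open>g\<close> at the first and last block, which is at most
  \<open>2 * G\<close>. For \<open>0 < n\<close> this bounded term is absorbed into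
  \<open>C * real n\<close>.\<close>

lemma block_sum_variance:
  assumes "M \<le> L"
  obtains C where "0 \<le> C"
    "\<And>n. 0 < n \<Longrightarrow> ex (n + L) (\<lambda>u. ((\<Sum>i<n. f (take L (drop i u))) - real n * ex L f)\<^sup>2) \<le> C * real n"
proof -
  obtain g where g: "\<And>y. set y \<subseteq> A \<Longrightarrow> length y = L \<Longrightarrow> 0 < p y \<Longrightarrow> g y - step g y = f y - ex L f"
    using poisson_equation[of L f] by blast
  define G where "G = (\<Sum>y\<in>words A L. \<bar>g y\<bar>)"
  define D where "D = G + (\<Sum>y\<in>words A L. \<bar>step g y\<bar>)"
  have G: "\<bar>g y\<bar> \<le> G" if "y \<in> words A L" for y
    unfolding G_def using that by (intro member_le_sum) auto
  have D: "\<bar>g z - step g y\<bar> \<le> D" if "y \<in> words A L" "z \<in> words A L" for y z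
    using G[OF that(2)] member_le_sum[of y "words A L" "\<lambda>y. \<bar>step g y\<bar>"] that(1)
    unfolding D_def by auto
  define T where "T n u = (\<Sum>i<n. g (take L (drop (Suc i) u)) - step g (take L (drop i u)))" for n u
  have bound: "ex (n + L) (\<lambda>u. ((\<Sum>i<n. f (take L (drop i u))) - real n * ex L f)\<^sup>2) \<le> (2 * D\<^sup>2 + 8 * G\<^sup>2) * real n"
    if n: "0 < n" for n
  proof -
    have "ex (n + L) (\<lambda>u. ((\<Sum>i<n. f (take L (drop i u))) - real n * ex L f)\<^sup>2)
        \<le> ex (n + L) (\<lambda>u. 2 * (T n u)\<^sup>2 + 8 * G\<^sup>2)"
    proof (rule ex_mono)
      fix u assume u: "set u \<subseteq> A" "length u = n + L" "0 < p u"
      have blk: "take L (drop i u) \<in> words A L" "0 < p (take L (drop i u))" if "i \<le> n" for i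
        using u that p_drop_pos[of u i] p_take_pos[of "drop i u" L] set_drop_subset[of i u]
          set_take_subset[of L "drop i u"] by auto
      have "(\<Sum>i<n. f (take L (drop i u))) - real n * ex L f
          = (\<Sum>i<n. g (take L (drop i u)) - step g (take L (drop i u)))"
        using blk by (simp add: g sum_subtractf)
      also have "\<dots> = T n u + (\<Sum>i<n. g (take L (drop i u)) - g (take L (drop (Suc i) u)))"
        unfolding T_def sum.distrib[symmetric] by (simp add: algebra_simps)
      also have "(\<Sum>i<n. g (take L (drop i u)) - g (take L (drop (Suc i) u)))
          = g (take L (drop 0 u)) - g (take L (drop n u))"
        by (rule sum_lessThan_telescope')
      finally have eq: "(\<Sum>i<n. f (take L (drop i u))) - real n * ex L f
          = T n u + (g (take L (drop 0 u)) - g (take L (drop n u)))" .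
      have "\<bar>g (take L (drop 0 u)) - g (take L (drop n u))\<bar> \<le> 2 * G"
        using G[OF blk(1), of 0] G[OF blk(1), of n] by auto
      then have "(g (take L (drop 0 u)) - g (take L (drop n u)))\<^sup>2 \<le> (2 * G)\<^sup>2"
        using abs_le_square_iff[of "g (take L (drop 0 u)) - g (take L (drop n u))" "2 * G"] by auto
      \<comment> \<open>This is the estimate of the square of a sum by twice the sum of the squares;
        the discarded part is the square of the difference.\<close>
      then show "((\<Sum>i<n. f (take L (drop i u))) - real n * ex L f)\<^sup>2 \<le> 2 * (T n u)\<^sup>2 + 8 * G\<^sup>2"
        unfolding eq using zero_le_power2[of "T n u - (g (take L (drop 0 u)) - g (take L (drop n u)))"]
        unfolding power2_sum power2_diff power_mult_distrib by (simp add: power2_eq_square)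
    qed
    also have "\<dots> = 2 * ex (n + L) (\<lambda>u. (T n u)\<^sup>2) + 8 * G\<^sup>2"
      by (simp add: ex_add ex_cmult ex_const)
    also have "\<dots> \<le> 2 * (real n * D\<^sup>2) + 8 * G\<^sup>2"
      using martingale_second_moment[OF assms D, of n] unfolding T_def by simp
    also have "\<dots> \<le> 2 * (real n * D\<^sup>2) + 8 * G\<^sup>2 * real n"
      using n mult_left_mono[of 1 "real n" "8 * G\<^sup>2"] by simp
    finally show ?thesis by (simp add: algebra_simps)
  qed
  show ?thesis by (rule that[OF _ bound]) auto
qed

end

section \<open>From processes to laws on words\<close>

definition block :: "(nat \<Rightarrow> 'w \<Rightarrow> 'a) \<Rightarrow> nat \<Rightarrow> nat \<Rightarrow> 'w \<Rightarrow> 'a list" where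
  "block X i n \<omega> = map (\<lambda>j. X (i + j) \<omega>) [0..<n]"

lemma initial_word_eq_block: "initial_word X n = block X 0 n"
  by (simp add: initial_word_def block_def fun_eq_iff)

lemma length_block [simp]: "length (block X i n \<omega>) = n"
  by (simp add: block_def)

lemma length_initial_word [simp]: "length (initial_word X n \<omega>) = n"
  by (simp add: initial_word_def)

lemma take_drop_initial_word:
  "i + k \<le> n \<Longrightarrow> take k (drop i (initial_word X n \<omega>)) = block X i k \<omega>"
  by (auto simp: block_def initial_word_def list_eq_iff_nth_eq)

lemma take_initial_word: "k \<le> n \<Longrightarrow> take k (initial_word X n \<omega>) = initial_word X k \<omega>"
  by (auto simp: initial_word_def list_eq_iff_nth_eq)

lemma initial_word_Suc: "initial_word X (Suc n) \<omega> = initial_word X n \<omega> @ [X n \<omega>]"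
  by (simp add: initial_word_def)

locale finite_process = prob_space P
  for P :: "'w measure" +
  fixes A :: "'a set" and X :: "nat \<Rightarrow> 'w \<Rightarrow> 'a"
  assumes fin_A: "finite A"
    and X_measurable: "\<And>i. X i \<in> measurable P (count_space A)"
    and stationary: "stationary_process P A X"
begin

abbreviation p :: "'a list \<Rightarrow> real" where
  "p \<equiv> block_prob P X"

lemma X_in_A: "\<omega> \<in> space P \<Longrightarrow> X i \<omega> \<in> A"
  using measurable_space[OF X_measurable, of \<omega> i] by simp

lemma set_block: "\<omega> \<in> space P \<Longrightarrow> set (block X i n \<omega>) \<subseteq> A"
  by (auto simp: block_def X_in_A)

lemma set_initial_word: "\<omega> \<in> space P \<Longrightarrow> set (initial_word X n \<omega>) \<subseteq> A"
  by (simp add: initial_word_eq_block set_block)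

lemma sets_X_eq: "{\<omega> \<in> space P. X i \<omega> = b} \<in> events"
proof (cases "b \<in> A")
  case True
  have "X i -` {b} \<inter> space P \<in> events"
    using X_measurable[of i] by (rule measurable_sets) (use True in simp)
  then show ?thesis by (simp add: vimage_def Int_def conj_commute)
next
  case False
  then have "{\<omega> \<in> space P. X i \<omega> = b} = {}" using X_in_A by auto
  then show ?thesis by (simp only: sets.empty_sets)
qed

lemma sets_block_eq: "{\<omega> \<in> space P. block X i n \<omega> = w} \<in> events"
proof (cases "length w = n")
  case True
  then have "{\<omega> \<in> space P. block X i n \<omega> = w} = {\<omega> \<in> space P. \<forall>j<n. X (i + j) \<omega> = w ! j}"
    by (auto simp: block_def list_eq_iff_nth_eq)
  also have "\<dots> \<in> events"
    by (intro sets.sets_Collect_countable_All sets.sets_Collect_imp sets_X_eq sets.sets_Collect_const)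
  finally show ?thesis .
next
  case False
  then have "{\<omega> \<in> space P. block X i n \<omega> = w} = {}" by auto
  then show ?thesis by (simp only: sets.empty_sets)
qed

lemma finite_Collect_words [simp]: "finite {w. set w \<subseteq> A \<and> length w = n \<and> Q w}"
  by (rule finite_subset[OF _ finite_words[OF fin_A, of n]]) auto

lemma Collect_block:
  "{\<omega> \<in> space P. Q (block X i n \<omega>)} = (\<Union>w\<in>{w \<in> words A n. Q w}. {\<omega> \<in> space P. block X i n \<omega> = w})"
  using set_block by auto

lemma sets_block: "{\<omega> \<in> space P. Q (block X i n \<omega>)} \<in> events"
  unfolding Collect_block
  by (intro sets.finite_UN sets_block_eq) simp

lemma sets_initial_word: "{\<omega> \<in> space P. Q (initial_word X n \<omega>)} \<in> events"
  unfolding initial_word_eq_block by (rule sets_block)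

lemma paths_measurable: "(\<lambda>\<omega> i. X (k i) \<omega>) \<in> measurable P (path_space A)"
  unfolding path_space_def
  by (rule measurable_PiM_single') (auto simp: X_measurable X_in_A)

lemma sets_cylinder:
  "{s \<in> space (path_space A). map (\<lambda>j. s (i + j)) [0..<n] = w} \<in> sets (path_space A)"
proof (cases "length w = n")
  case True
  have coord: "{s \<in> space (path_space A). s j = b} \<in> sets (path_space A)" for j b
  proof (cases "b \<in> A")
    case True
    have "(\<lambda>s. s j) \<in> measurable (path_space A) (count_space A)"
      unfolding path_space_def by (rule measurable_component_singleton) simp
    then have "(\<lambda>s. s j) -` {b} \<inter> space (path_space A) \<in> sets (path_space A)"
      by (rule measurable_sets) (use True in simp)
    then show ?thesis by (simp add: vimage_def Int_def conj_commute)
  next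
    case False
    then have "{s \<in> space (path_space A). s j = b} = {}"
      by (auto simp: path_space_def space_PiM PiE_iff)
    then show ?thesis by (simp only: sets.empty_sets)
  qed
  have "{s \<in> space (path_space A). map (\<lambda>j. s (i + j)) [0..<n] = w}
      = {s \<in> space (path_space A). \<forall>j<n. s (i + j) = w ! j}"
    using True by (auto simp: list_eq_iff_nth_eq)
  also have "\<dots> \<in> sets (path_space A)"
    by (intro sets.sets_Collect_countable_All sets.sets_Collect_imp coord sets.sets_Collect_const)
  finally show ?thesis .
next
  case False
  then have "{s \<in> space (path_space A). map (\<lambda>j. s (i + j)) [0..<n] = w} = {}" by auto
  then show ?thesis by (simp only: sets.empty_sets)
qed

text \<open>Stationarity of the path law moves a cylinder from time \<open>Suc i\<close> to time
  \<open>i\<close>, so induction brings it down to time 0.\<close>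

lemma prob_block_eq: "prob {\<omega> \<in> space P. block X i (length w) \<omega> = w} = p w"
proof (induction i)
  case 0
  show ?case by (simp add: block_prob_def initial_word_eq_block)
next
  case (Suc i)
  let ?B = "{s \<in> space (path_space A). map (\<lambda>j. s (i + j)) [0..<length w] = w}"
  have inv: "(\<lambda>\<omega> i. X (k i) \<omega>) -` ?B \<inter> space P
      = {\<omega> \<in> space P. map (\<lambda>j. X (k (i + j)) \<omega>) [0..<length w] = w}" for k
    using measurable_space[OF paths_measurable, of _ k] by auto
  have "measure (distr P (path_space A) (\<lambda>\<omega> i. X (Suc i) \<omega>)) ?B
      = measure (distr P (path_space A) (\<lambda>\<omega> i. X i \<omega>)) ?B"
    using stationary by (simp add: stationary_process_def)
  then have "prob {\<omega> \<in> space P. map (\<lambda>j. X (Suc (i + j)) \<omega>) [0..<length w] = w}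
      = prob {\<omega> \<in> space P. map (\<lambda>j. X (i + j) \<omega>) [0..<length w] = w}"
    using sets_cylinder[of i "length w" w] inv[of Suc] inv[of "\<lambda>i. i"]
      paths_measurable[of Suc] paths_measurable[of "\<lambda>i. i"] by (simp add: measure_distr)
  then show ?case using Suc by (simp add: block_def)
qed

lemma prob_block:
  "prob {\<omega> \<in> space P. Q (block X i n \<omega>)} = (\<Sum>w | w \<in> words A n \<and> Q w. p w)"
proof -
  have "prob {\<omega> \<in> space P. Q (block X i n \<omega>)}
      = (\<Sum>w | w \<in> words A n \<and> Q w. prob {\<omega> \<in> space P. block X i n \<omega> = w})"
    unfolding Collect_block
  proof (rule finite_measure_finite_Union)
    show "(\<lambda>w. {\<omega> \<in> space P. block X i n \<omega> = w}) ` {w \<in> words A n. Q w} \<subseteq> events"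
      using sets_block_eq by blast
  qed (auto simp: disjoint_family_on_def finite_words[OF fin_A])
  also have "\<dots> = (\<Sum>w | w \<in> words A n \<and> Q w. p w)"
  proof (rule sum.cong[OF refl])
    fix w assume "w \<in> {w \<in> words A n. Q w}"
    then show "prob {\<omega> \<in> space P. block X i n \<omega> = w} = p w"
      using prob_block_eq[of i w] by auto
  qed
  finally show ?thesis .
qed

sublocale word_law A p
proof
  show "finite A" by (rule fin_A)
  show "0 \<le> p w" for w by (simp add: block_prob_def)
  show "p [] = 1" by (simp add: block_prob_def initial_word_def prob_space)
next
  fix w assume w: "set w \<subseteq> A"
  have "p w = prob {\<omega> \<in> space P. take (length w) (block X 0 (Suc (length w)) \<omega>) = w}"
    by (simp add: block_prob_def initial_word_eq_block[symmetric] take_initial_word)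
  also have "\<dots> = (\<Sum>u | u \<in> words A (Suc (length w)) \<and> take (length w) u = w. p u)"
    by (rule prob_block)
  also have "\<dots> = (\<Sum>b\<in>A. p (w @ [b]))"
    by (rule sum.reindex_bij_witness[where j = last and i = "\<lambda>b. w @ [b]"])
      (use w in \<open>auto simp: length_Suc_conv_rev\<close>)
  finally show "(\<Sum>b\<in>A. p (w @ [b])) = p w" by simp
next
  fix w assume w: "set w \<subseteq> A"
  \<comment> \<open>Consistency on the left is where stationarity enters: the block at time 1 has
    the law of the block at time 0.\<close>
  have "block X 1 n \<omega> = drop 1 (block X 0 (Suc n) \<omega>)" for n \<omega>
    by (auto simp: block_def list_eq_iff_nth_eq simp del: upt_Suc)
  then have "p w = prob {\<omega> \<in> space P. drop 1 (block X 0 (Suc (length w)) \<omega>) = w}"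
    using prob_block_eq[of 1 w] by simp
  also have "\<dots> = (\<Sum>u | u \<in> words A (Suc (length w)) \<and> drop 1 u = w. p u)"
    by (rule prob_block)
  also have "\<dots> = (\<Sum>a\<in>A. p (a # w))"
    by (rule sum.reindex_bij_witness[where j = hd and i = "\<lambda>b. b # w"])
      (use w in \<open>auto simp: length_Suc_conv\<close>)
  finally show "(\<Sum>a\<in>A. p (a # w)) = p w" by simp
qed

lemma prob_initial_word:
  "prob {\<omega> \<in> space P. Q (initial_word X n \<omega>)} = ex n (\<lambda>w. of_bool (Q w))"
  unfolding initial_word_eq_block prob_block ex_def
  by (rule sum.mono_neutral_cong_left) auto

lemma next_prob_eq_nx: "next_prob P X w b = nx w b"
proof -
  have "{\<omega> \<in> space P. X (length w) \<omega> = b \<and> initial_word X (length w) \<omega> = w}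
      = {\<omega> \<in> space P. initial_word X (length (w @ [b])) \<omega> = w @ [b]}"
    by (auto simp: initial_word_Suc)
  then show ?thesis by (simp add: next_prob_def cond_prob_def nx_def block_prob_def)
qed

text \<open>Each length has finitely many null words and there are countably many lengths. Outside
  this null event, logarithms of likelihoods make sense along the whole path.\<close>

lemma AE_p_pos: "AE \<omega> in P. \<forall>n. 0 < p (initial_word X n \<omega>)"
proof -
  have "AE \<omega> in P. 0 < p (initial_word X n \<omega>)" for n
  proof -
    have "prob {\<omega> \<in> space P. p (initial_word X n \<omega>) = 0} = 0"
      unfolding prob_initial_word[where Q = "\<lambda>w. p w = 0"] ex_def by (rule sum.neutral) auto
    then have "AE \<omega> in P. \<not> p (initial_word X n \<omega>) = 0"
      using sets_initial_word[of "\<lambda>w. p w = 0" n] by (simp add: AE_iff_measurable[OF _ refl] emeasure_eq_measure)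
    then show ?thesis
      by eventually_elim (use p_nonneg in \<open>auto simp: order.order_iff_strict\<close>)
  qed
  then show ?thesis by (simp add: AE_all_countable)
qed

lemma p_block_pos:
  assumes "\<forall>n. 0 < p (initial_word X n \<omega>)" "\<omega> \<in> space P"
  shows "0 < p (block X i n \<omega>)"
proof -
  have "set (initial_word X (i + n) \<omega>) \<subseteq> A" by (rule set_initial_word[OF assms(2)])
  then have "0 < p (take n (drop i (initial_word X (i + n) \<omega>)))"
    using assms(1) set_drop_subset[of i "initial_word X (i + n) \<omega>"]
    by (intro p_take_pos p_drop_pos) auto
  then show ?thesis by (simp only: take_drop_initial_word order_refl)
qed

text \<open>Almost surely \<open>g\<close> is constant along the blocks of the path, so the event
  that it eventually equals \<open>g y\<close> agrees with the event that it does so at time 0. That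
  event is invariant and has probability at least \<open>p y\<close>, hence 1, which leaves no mass
  for \<open>z\<close>.\<close>

lemma ergodic_law:
  fixes g :: "'a list \<Rightarrow> real"
  assumes erg: "ergodic_process P A X"
    and g: "\<And>u. set u \<subseteq> A \<Longrightarrow> length u = Suc L \<Longrightarrow> 0 < p u \<Longrightarrow> g (tl u) = g (butlast u)"
    and y: "set y \<subseteq> A" "length y = L" "0 < p y" and z: "set z \<subseteq> A" "length z = L" "0 < p z"
  shows "g y = g z"
proof (rule ccontr)
  assume neq: "g y \<noteq> g z"
  let ?s = "\<lambda>s i. map (\<lambda>j. s (i + j)) [0..<L]"
  \<comment> \<open>The word "eventually" makes \<open>B\<close> invariant at every point of the
    path space, as the definition of ergodicity demands, and not only almost everywhere.\<close>
  define B where "B = {s \<in> space (path_space A). \<exists>N. \<forall>i\<ge>N. g (?s s i) = g y}"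
  have "{s \<in> space (path_space A). g (?s s i) = g y} \<in> sets (path_space A)" for i
  proof -
    have "{s \<in> space (path_space A). g (?s s i) = g y}
        = (\<Union>w\<in>{w \<in> words A L. g w = g y}. {s \<in> space (path_space A). ?s s i = w})"
      by (auto simp: path_space_def space_PiM PiE_iff)
    also have "\<dots> \<in> sets (path_space A)" by (intro sets.finite_UN sets_cylinder) simp
    finally show ?thesis .
  qed
  then have B: "B \<in> sets (path_space A)"
    unfolding B_def
    by (intro sets.sets_Collect_countable_Ex sets.sets_Collect_countable_All sets.sets_Collect_imp
        sets.sets_Collect_const) 
  have "(\<lambda>i. s (Suc i)) \<in> B \<longleftrightarrow> s \<in> B" if s: "s \<in> space (path_space A)" for s
  proof -
    have "(\<exists>N. \<forall>i\<ge>N. g (?s (\<lambda>i. s (Suc i)) i) = g y) \<longleftrightarrow> (\<exists>N. \<forall>i\<ge>N. g (?s s (Suc i)) = g y)"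
      by simp
    also have "\<dots> \<longleftrightarrow> (\<exists>N. \<forall>i\<ge>N. g (?s s i) = g y)"
      using eventually_sequentially_Suc[of "\<lambda>i. g (?s s i) = g y"]
      by (simp only: eventually_sequentially)
    finally show ?thesis
      using s by (auto simp: B_def path_space_def space_PiM PiE_iff)
  qed
  then have "measure (distr P (path_space A) (\<lambda>\<omega> i. X i \<omega>)) B \<in> {0, 1}"
    using erg B unfolding ergodic_process_def by blast
  then have "prob {\<omega> \<in> space P. (\<lambda>i. X i \<omega>) \<in> B} \<in> {0, 1}"
    using B paths_measurable[of "\<lambda>i. i"] by (simp add: measure_distr vimage_def Int_def conj_commute)
  also have "prob {\<omega> \<in> space P. (\<lambda>i. X i \<omega>) \<in> B} = prob {\<omega> \<in> space P. g (block X 0 L \<omega>) = g y}"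
  proof (rule prob_eq_AE)
    show "AE \<omega> in P. (\<lambda>i. X i \<omega>) \<in> B \<longleftrightarrow> g (block X 0 L \<omega>) = g y"
      using AE_p_pos AE_space
    proof eventually_elim
      case (elim \<omega>)
      have "g (block X (Suc i) L \<omega>) = g (block X i L \<omega>)" for i
      proof -
        have "tl (block X i (Suc L) \<omega>) = block X (Suc i) L \<omega>"
          by (auto simp: block_def list_eq_iff_nth_eq nth_tl simp del: upt_Suc)
        moreover have "butlast (block X i (Suc L) \<omega>) = block X i L \<omega>"
          by (simp add: block_def)
        ultimately show ?thesis
          using g[of "block X i (Suc L) \<omega>"] set_block[OF elim(2), of i "Suc L"] p_block_pos[OF elim, of i "Suc L"]
          by simp
      qed
      then have const: "g (block X i L \<omega>) = g (block X 0 L \<omega>)" for i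
        by (induction i) auto
      have "(\<lambda>i. X i \<omega>) \<in> B \<longleftrightarrow> (\<exists>N. \<forall>i\<ge>N. g (block X i L \<omega>) = g y)"
        using measurable_space[OF paths_measurable[of "\<lambda>i. i"] elim(2)] by (simp add: B_def block_def)
      also have "\<dots> \<longleftrightarrow> g (block X 0 L \<omega>) = g y"
        using const by (metis order_refl)
      finally show ?case .
    qed
    show "{\<omega> \<in> space P. g (block X 0 L \<omega>) = g y} \<in> events" by (rule sets_block)
    show "{\<omega> \<in> space P. (\<lambda>i. X i \<omega>) \<in> B} \<in> events"
      using measurable_sets[OF paths_measurable[of "\<lambda>i. i"] B] by (simp add: vimage_def Int_def conj_commute)
  qed
  also have "\<dots> = (\<Sum>w | w \<in> words A L \<and> g w = g y. p w)" by (rule prob_block)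
  finally have 01: "(\<Sum>w | w \<in> words A L \<and> g w = g y. p w) \<in> {0, 1}" .
  have "p y \<le> (\<Sum>w | w \<in> words A L \<and> g w = g y. p w)"
    using y p_nonneg by (intro member_le_sum) auto
  then have 1: "(\<Sum>w | w \<in> words A L \<and> g w = g y. p w) = 1" using 01 y(3) by auto
  have "(\<Sum>w\<in>insert z {w \<in> words A L. g w = g y}. p w) \<le> (\<Sum>w\<in>words A L. p w)"
    using z p_nonneg by (intro sum_mono2) auto
  then show False using neq z(3) 1 by (subst (asm) sum.insert) (auto simp: sum_p_words)
qed

end

text \<open>Here \<open>M\<close> is a bound on the memory, so that order 0 and positive orders are
  treated alike; minimality enters with \<open>order_estimate_tendsto\<close>.\<close>

locale ergodic_markov_process = finite_process +
  fixes M :: nat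
  assumes ergodic_process: "ergodic_process P A X"
    and memory_at_most: "memory_at_most P A X M"
begin

sublocale markov_law A p M
proof
  fix w b assume "set w \<subseteq> A" "b \<in> A" "M \<le> length w" "0 < p w"
  then show "nx w b = nx (drop (length w - M) w) b"
    using memory_at_most unfolding memory_at_most_def next_prob_eq_nx by blast
next
  fix L g y z
  assume "\<And>u. set u \<subseteq> A \<Longrightarrow> length u = Suc L \<Longrightarrow> 0 < p u \<Longrightarrow> g (tl u) = (g (butlast u) :: real)"
    and "set y \<subseteq> A" "length y = L" "0 < p y" "set z \<subseteq> A" "length z = L" "0 < p z"
  then show "g y = g z" by (rule ergodic_law[OF ergodic_process])
qed

end

section \<open>A law of large numbers with a rate\<close>

lemma take_block: "k \<le> n \<Longrightarrow> take k (block X i n \<omega>) = block X i k \<omega>"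
  by (rule nth_equalityI) (simp_all add: block_def)

lemma cube_interval:
  obtains j :: nat where "j ^ 3 \<le> n" "n < Suc j ^ 3"
proof -
  define j where "j = (LEAST m. n < Suc m ^ 3)"
  have "n < Suc n ^ 3"
    using power_increasing[of 1 3 "Suc n"] by simp
  then have 1: "n < Suc j ^ 3" unfolding j_def by (rule LeastI)
  have "j ^ 3 \<le> n"
  proof (cases j)
    case (Suc m)
    then have "\<not> n < Suc m ^ 3" using not_less_Least[of m "\<lambda>m. n < Suc m ^ 3"] by (simp add: j_def)
    then show ?thesis using Suc by simp
  qed simp
  then show ?thesis using 1 that by blast
qed

context ergodic_markov_process
begin

lemma block_sum_chebyshev:
  assumes "M \<le> L"
  obtains C where "0 \<le> C"
    "\<And>n t. 0 < n \<Longrightarrow> 0 < t \<Longrightarrow>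
      prob {\<omega> \<in> space P. t < \<bar>(\<Sum>i<n. f (block X i L \<omega>)) - real n * ex L f\<bar>} \<le> C * real n / t\<^sup>2"
proof -
  obtain C where C: "0 \<le> C" and var:
    "\<And>n. 0 < n \<Longrightarrow> ex (n + L) (\<lambda>u. ((\<Sum>i<n. f (take L (drop i u))) - real n * ex L f)\<^sup>2) \<le> C * real n"
    using block_sum_variance[OF assms, of f] by blast
  have "prob {\<omega> \<in> space P. t < \<bar>(\<Sum>i<n. f (block X i L \<omega>)) - real n * ex L f\<bar>} \<le> C * real n / t\<^sup>2"
    if n: "0 < n" and t: "0 < t" for n t
  proof -
    define Z where "Z u = (\<Sum>i<n. f (take L (drop i u))) - real n * ex L f" for u
    have "prob {\<omega> \<in> space P. t < \<bar>(\<Sum>i<n. f (block X i L \<omega>)) - real n * ex L f\<bar>}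
        = prob {\<omega> \<in> space P. t < \<bar>Z (initial_word X (n + L) \<omega>)\<bar>}"
      by (simp add: Z_def take_drop_initial_word)
    also have "\<dots> = ex (n + L) (\<lambda>u. of_bool (t < \<bar>Z u\<bar>))"
      by (rule prob_initial_word)
    also have "\<dots> \<le> ex (n + L) (\<lambda>u. (1 / t\<^sup>2) * (Z u)\<^sup>2)"
    proof (rule ex_mono)
      fix u
      have "t\<^sup>2 \<le> (Z u)\<^sup>2" if "t < \<bar>Z u\<bar>"
        using that t power_mono[of t "\<bar>Z u\<bar>" 2] by simp
      then show "of_bool (t < \<bar>Z u\<bar>) \<le> (1 / t\<^sup>2) * (Z u)\<^sup>2"
        using t by (auto simp: of_bool_def field_simps)
    qed
    also have "\<dots> \<le> C * real n / t\<^sup>2"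
      unfolding ex_cmult using var[OF n] t by (simp add: Z_def divide_right_mono)
    finally show ?thesis .
  qed
  then show ?thesis using C that by blast
qed

text \<open>Chebyshev's inequality is summable along the cubes, and the gaps between consecutive cubes
  are negligible compared with \<open>n powr (3/4)\<close>.\<close>

lemma block_sum_rate:
  assumes L: "M \<le> L" and \<delta>: "0 < \<delta>"
  shows "AE \<omega> in P. \<forall>\<^sub>F n in sequentially.
    \<bar>(\<Sum>i<n. f (block X i L \<omega>)) - real n * ex L f\<bar> \<le> \<delta> * real n powr (3/4)"
proof -
  define Z where "Z n \<omega> = (\<Sum>i<n. f (block X i L \<omega>)) - real n * ex L f" for n \<omega>
  obtain C where C: "0 \<le> C" and cheb: "\<And>n t. 0 < n \<Longrightarrow> 0 < t \<Longrightarrow>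
      prob {\<omega> \<in> space P. t < \<bar>Z n \<omega>\<bar>} \<le> C * real n / t\<^sup>2"
    using block_sum_chebyshev[OF L, of f] unfolding Z_def by blast
  \<comment> \<open>At the cube of \<open>j\<close> the bound \<open>n powr (3/4)\<close> reads
    \<open>j powr (9/4)\<close>, and Chebyshev gives a multiple of \<open>j powr (-3/2)\<close>. The
    other half of \<delta> is reserved for the gaps.\<close>
  define E where "E j = {\<omega> \<in> space P. \<delta> / 2 * real j powr (9/4) < \<bar>Z (j ^ 3) \<omega>\<bar>}" for j
  have E_events: "E j \<in> events" for j
  proof -
    define Q where "Q u \<longleftrightarrow> \<delta> / 2 * real j powr (9/4) <
        \<bar>(\<Sum>i<j ^ 3. f (take L (drop i u))) - real (j ^ 3) * ex L f\<bar>" for u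
    have "E j = {\<omega> \<in> space P. Q (initial_word X (j ^ 3 + L) \<omega>)}"
      by (simp add: E_def Z_def Q_def take_drop_initial_word)
    then show ?thesis using sets_initial_word[of Q] by simp
  qed
  have E_le: "prob (E j) \<le> 4 * C / \<delta>\<^sup>2 * real j powr (-3/2)" if "1 \<le> j" for j
  proof -
    have "prob (E j) \<le> C * real (j ^ 3) / (\<delta> / 2 * real j powr (9/4))\<^sup>2"
      unfolding E_def using that \<delta> by (intro cheb) auto
    also have "(\<delta> / 2 * real j powr (9/4))\<^sup>2 = \<delta>\<^sup>2 / 4 * real j powr (9/2)"
      by (simp add: power2_eq_square powr_add[symmetric])
    also have "real (j ^ 3) = real j powr 3" using that by simp
    also have "C * real j powr 3 / (\<delta>\<^sup>2 / 4 * real j powr (9/2)) = 4 * C / \<delta>\<^sup>2 * (real j powr 3 / real j powr (9/2))"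
      using \<delta> by simp
    also have "real j powr 3 / real j powr (9/2) = real j powr (-3/2)"
      by (simp only: powr_diff[symmetric]) simp
    finally show ?thesis .
  qed
  have "summable (\<lambda>j. prob (E j))"
  proof (rule summable_comparison_test)
    show "\<exists>N. \<forall>n\<ge>N. norm (prob (E n)) \<le> 4 * C / \<delta>\<^sup>2 * real n powr (-3/2)"
      using E_le by (intro exI[of _ 1]) auto
    show "summable (\<lambda>n. 4 * C / \<delta>\<^sup>2 * real n powr (-3/2))"
      by (intro summable_mult) (simp add: summable_real_powr_iff)
  qed
  then have "AE \<omega> in P. \<forall>\<^sub>F j in sequentially. \<omega> \<in> space P - E j"
    by (intro borel_cantelli_AE1 E_events) (auto simp: emeasure_eq_measure)
  then have "AE \<omega> in P. \<forall>\<^sub>F n in sequentially. \<bar>Z n \<omega>\<bar> \<le> \<delta> * real n powr (3/4)"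
    using AE_space
  proof eventually_elim
    case (elim \<omega>)
    \<comment> \<open>\<open>B\<close> bounds a single centred term. The at most
      \<open>7 * j^2\<close> terms after the last cube then contribute a quantity of smaller order
      than \<open>j powr (9/4)\<close>.\<close>
    define B where "B = (\<Sum>y\<in>words A L. \<bar>f y - ex L f\<bar>)"
    have B: "\<bar>f (block X i L \<omega>) - ex L f\<bar> \<le> B" for i
      unfolding B_def using set_block[OF elim(2)] by (intro member_le_sum) auto
    have "\<forall>\<^sub>F j in sequentially. 7 * B * (real j)\<^sup>2 \<le> \<delta> / 2 * real j powr (9/4)"
      using \<delta> by real_asymp
    with elim(1) have "\<forall>\<^sub>F j in sequentially. \<bar>Z (j ^ 3) \<omega>\<bar> \<le> \<delta> / 2 * real j powr (9/4) \<and>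
        7 * B * (real j)\<^sup>2 \<le> \<delta> / 2 * real j powr (9/4)"
      by eventually_elim (auto simp: E_def)
    then obtain J where J: "\<And>j. J \<le> j \<Longrightarrow> \<bar>Z (j ^ 3) \<omega>\<bar> \<le> \<delta> / 2 * real j powr (9/4)"
      "\<And>j. J \<le> j \<Longrightarrow> 7 * B * (real j)\<^sup>2 \<le> \<delta> / 2 * real j powr (9/4)"
      by (auto simp: eventually_sequentially)
    have "\<bar>Z n \<omega>\<bar> \<le> \<delta> * real n powr (3/4)" if n: "(J + 1) ^ 3 \<le> n" for n
    proof -
      obtain j where j: "j ^ 3 \<le> n" "n < Suc j ^ 3" by (rule cube_interval)
      have "(J + 1) ^ 3 < Suc j ^ 3" using n j(2) by linarith
      then have "J + 1 < Suc j" by (rule power_less_imp_less_base) simp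
      then have Jj: "J \<le> j" and j1: "1 \<le> j" by auto
      have "real n \<le> real (Suc j ^ 3) - 1" using j(2) by linarith
      also have "\<dots> = real j ^ 3 + 3 * (real j)\<^sup>2 + 3 * real j"
        by (simp add: power3_eq_cube power2_eq_square algebra_simps)
      also have "\<dots> \<le> real j ^ 3 + 7 * (real j)\<^sup>2"
        using j1 mult_right_mono[of 1 "real j" "real j"] by (simp add: power2_eq_square)
      finally have gap: "real (n - j ^ 3) \<le> 7 * (real j)\<^sup>2" using j(1) by (simp add: of_nat_diff)
      have Z_sum: "Z n \<omega> = (\<Sum>i<n. f (block X i L \<omega>) - ex L f)" for n
        by (simp add: Z_def sum_subtractf)
      have "{..<n} = {..<j ^ 3} \<union> {j ^ 3..<n}" using j(1) by auto
      then have "Z n \<omega> = (\<Sum>i\<in>{..<j ^ 3} \<union> {j ^ 3..<n}. f (block X i L \<omega>) - ex L f)"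
        by (simp only: Z_sum)
      also have "\<dots> = Z (j ^ 3) \<omega> + (\<Sum>i=j ^ 3..<n. f (block X i L \<omega>) - ex L f)"
        unfolding Z_sum by (rule sum.union_disjoint) auto
      also have "\<bar>\<dots>\<bar> \<le> \<bar>Z (j ^ 3) \<omega>\<bar> + \<bar>\<Sum>i=j ^ 3..<n. f (block X i L \<omega>) - ex L f\<bar>"
        by (rule abs_triangle_ineq)
      also have "\<bar>\<Sum>i=j ^ 3..<n. f (block X i L \<omega>) - ex L f\<bar> \<le> (\<Sum>i=j ^ 3..<n. B)"
        by (intro order.trans[OF sum_abs] sum_mono B)
      also have "\<dots> = B * real (n - j ^ 3)" by simp
      also have "\<dots> \<le> B * (7 * (real j)\<^sup>2)"
        using gap B[of 0] by (intro mult_left_mono) auto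
      finally have "\<bar>Z n \<omega>\<bar> \<le> \<delta> / 2 * real j powr (9/4) + \<delta> / 2 * real j powr (9/4)"
        using J[OF Jj] by (simp add: mult_ac)
      also have "\<dots> = \<delta> * (real j powr 3) powr (3/4)" by (simp only: powr_powr) simp
      also have "real j powr 3 = real (j ^ 3)" using j1 by simp
      also have "\<delta> * real (j ^ 3) powr (3/4) \<le> \<delta> * real n powr (3/4)"
        using j(1) \<delta> by (intro mult_left_mono powr_mono2) (auto simp flip: of_nat_power)
      finally show ?thesis .
    qed
    then show ?case by (auto simp: eventually_sequentially)
  qed
  then show ?thesis by (simp add: Z_def)
qed

lemma block_average:
  assumes L: "M \<le> L"
  shows "AE \<omega> in P. (\<lambda>n. (\<Sum>i<n. f (block X i L \<omega>)) / real n) \<longlonglongrightarrow> ex L f"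
proof -
  have "AE \<omega> in P. \<forall>\<^sub>F n in sequentially.
      \<bar>(\<Sum>i<n. f (block X i L \<omega>)) - real n * ex L f\<bar> \<le> 1 * real n powr (3/4)"
    by (rule block_sum_rate[OF L]) simp
  then show ?thesis
  proof eventually_elim
    case (elim \<omega>)
    let ?S = "\<lambda>n. \<Sum>i<n. f (block X i L \<omega>)"
    from elim have "\<forall>\<^sub>F n in sequentially. norm (?S n / real n - ex L f) \<le> real n powr (3/4) / real n"
      using eventually_gt_at_top[of 0]
    proof eventually_elim
      case (elim n)
      then have "?S n / real n - ex L f = (?S n - real n * ex L f) / real n"
        by (simp add: diff_divide_distrib)
      then have "norm (?S n / real n - ex L f) = \<bar>?S n - real n * ex L f\<bar> / real n"
        by (simp only: real_norm_def abs_divide abs_of_nat)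
      then show ?case using elim by (simp add: divide_right_mono)
    qed
    moreover have "(\<lambda>n. real n powr (3/4) / real n) \<longlonglongrightarrow> 0" by real_asymp
    ultimately have "(\<lambda>n. ?S n / real n - ex L f) \<longlonglongrightarrow> 0"
      by (rule Lim_null_comparison)
    then show ?case by (rule LIM_zero_cancel)
  qed
qed

section \<open>Block counts and frequencies\<close>

lemma count_block_initial_word:
  assumes "length a \<le> n"
  shows "real (count_block (initial_word X n \<omega>) a) = (\<Sum>i<n + 1 - length a. of_bool (block X i (length a) \<omega> = a))"
proof -
  have "{i. i + length a \<le> n \<and> take (length a) (drop i (initial_word X n \<omega>)) = a}
      = {i \<in> {..<n + 1 - length a}. block X i (length a) \<omega> = a}"
    using assms take_drop_initial_word[of _ "length a" n X \<omega>] by auto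
  then have "real (count_block (initial_word X n \<omega>) a)
      = (\<Sum>i\<in>{i \<in> {..<n + 1 - length a}. block X i (length a) \<omega> = a}. 1)"
    unfolding count_block_def by (simp only: length_initial_word) simp
  also have "\<dots> = (\<Sum>i<n + 1 - length a. of_bool (block X i (length a) \<omega> = a))"
    by (rule sum.mono_neutral_cong_left) auto
  finally show ?thesis .
qed

lemma ex_of_bool_eq:
  assumes "set a \<subseteq> A"
  shows "ex (length a) (\<lambda>w. of_bool (w = a)) = p a"
proof -
  have "ex (length a) (\<lambda>w. of_bool (w = a)) = (\<Sum>w\<in>words A (length a). if w = a then p w else 0)"
    unfolding ex_def by (rule sum.cong) auto
  also have "\<dots> = p a" using assms by (subst sum.delta) auto
  finally show ?thesis .
qed

lemma block_frequency:
  assumes a: "set a \<subseteq> A"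
  shows "AE \<omega> in P. (\<lambda>n. real (count_block (initial_word X n \<omega>) a) / real n) \<longlonglongrightarrow> p a"
proof -
  \<comment> \<open>The law of large numbers asks for blocks of length at least \<open>M\<close>, so
    \<open>a\<close> is read off the start of a longer block.\<close>
  define f where "f y = (of_bool (take (length a) y = a) :: real)" for y
  have "ex (length a + M) f = p a"
    unfolding f_def ex_take[of "length a" M "\<lambda>w. of_bool (w = a)"] by (rule ex_of_bool_eq[OF a])
  then have "AE \<omega> in P. (\<lambda>n. (\<Sum>i<n. f (block X i (length a + M) \<omega>)) / real n) \<longlonglongrightarrow> p a"
    using block_average[of "length a + M" f] by simp
  then show ?thesis
  proof eventually_elim
    case (elim \<omega>)
    have f: "f (block X i (length a + M) \<omega>) = of_bool (block X i (length a) \<omega> = a)" for i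
    proof -
      have "take (length a) (block X i (length a + M) \<omega>) = block X i (length a) \<omega>"
        by (rule take_block) simp
      then show ?thesis by (simp add: f_def)
    qed
    let ?S = "\<lambda>n. \<Sum>i<n. of_bool (block X i (length a) \<omega> = a) :: real"
    have lim: "(\<lambda>n. ?S n / real n) \<longlonglongrightarrow> p a" using elim by (simp add: f)
    \<comment> \<open>The count runs over \<open>n + 1 - length a\<close> positions rather than
      \<open>n\<close>; the ratio of the two tends to 1.\<close>
    have shift: "filterlim (\<lambda>n. n + 1 - length a) at_top sequentially"
      by (rule filterlim_at_top_mono[OF filterlim_minus_const_nat_at_top[of "length a"]])
        (auto intro!: always_eventually diff_le_mono)
    have "(\<lambda>n. real (n + 1 - length a) / real n) \<longlonglongrightarrow> 1"
    proof (rule Lim_transform_eventually)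
      show "(\<lambda>n. (real n + 1 - real (length a)) / real n) \<longlonglongrightarrow> 1" by real_asymp
      show "\<forall>\<^sub>F n in sequentially. (real n + 1 - real (length a)) / real n = real (n + 1 - length a) / real n"
        using eventually_ge_at_top[of "length a"] by eventually_elim (simp add: of_nat_diff)
    qed
    then have "(\<lambda>n. ?S (n + 1 - length a) / real (n + 1 - length a) * (real (n + 1 - length a) / real n)) \<longlonglongrightarrow> p a * 1"
      by (intro tendsto_mult filterlim_compose[OF lim shift])
    moreover have "\<forall>\<^sub>F n in sequentially.
        ?S (n + 1 - length a) / real (n + 1 - length a) * (real (n + 1 - length a) / real n)
        = real (count_block (initial_word X n \<omega>) a) / real n"
      using eventually_ge_at_top[of "length a"]
    proof eventually_elim
      case (elim n)
      then have "0 < real (n + 1 - length a)" by simp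
      then show ?case unfolding count_block_initial_word[OF elim] by simp
    qed
    ultimately show ?case by (simp add: Lim_transform_eventually)
  qed
qed

end

section \<open>Entropy\<close>

lemma initial_word_append: "initial_word X (m + n) \<omega> = initial_word X m \<omega> @ block X m n \<omega>"
  by (rule nth_equalityI) (auto simp: initial_word_def block_def nth_append simp del: upt_Suc)

lemma block_Suc: "block X i (Suc n) \<omega> = block X i n \<omega> @ [X (i + n) \<omega>]"
  by (simp add: block_def)

context word_law
begin

text \<open>The Shannon entropy of a letter given the \<open>k\<close> preceding ones, written as
  the mean of a function of one block so that the law of large numbers applies to it
  directly.\<close>

definition cond_entropy :: "nat \<Rightarrow> real" where
  "cond_entropy k = ex (Suc k) (\<lambda>y. - ln (nx (butlast y) (last y)))"

lemma nx_butlast_last_pos: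
  assumes "set y \<subseteq> A" "y \<noteq> []" "0 < p y"
  shows "0 < nx (butlast y) (last y)"
proof -
  have "0 < p (butlast y)" unfolding butlast_conv_take by (rule p_take_pos[OF assms(1,3)])
  then show ?thesis using assms by (simp add: nx_def)
qed

lemma cond_entropy_nonneg: "0 \<le> cond_entropy k"
proof -
  have "ex (Suc k) (\<lambda>_. 0) \<le> cond_entropy k"
    unfolding cond_entropy_def
  proof (rule ex_mono)
    fix y assume y: "set y \<subseteq> A" "length y = Suc k" "0 < p y"
    have "last y \<in> A" using y(1,2) by (cases y rule: rev_cases) auto
    then have "p (butlast y @ [last y]) \<le> p (butlast y)"
      using y by (intro p_append_le_left) (auto dest: in_set_butlastD)
    then have "nx (butlast y) (last y) \<le> 1"
      using p_nonneg[of "butlast y"] by (auto simp: nx_def divide_le_eq_1 order.order_iff_strict)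
    then show "0 \<le> - ln (nx (butlast y) (last y))"
      using nx_butlast_last_pos[of y] y by (metis Zero_not_Suc length_0_conv ln_le_zero_iff neg_0_le_iff_le)
  qed
  then show ?thesis by (simp add: ex_const)
qed

text \<open>\<open>cond_entropy k - cond_entropy M\<close> is the divergence of \<open>p\<close> on \<open>Suc M\<close>-blocks from the law
  that predicts the last letter with memory \<open>k\<close>, and it vanishes only if the two laws agree.\<close>

lemma cond_entropy_gap:
  assumes k: "k \<le> M" and le: "cond_entropy k \<le> cond_entropy M"
    and w: "set w \<subseteq> A" "length w = M" and b: "b \<in> A"
  shows "p (w @ [b]) = p w * nx (drop (M - k) w) b"
proof -
  define j where "j = M - k"
  define q where "q y = p (butlast y) * nx (drop j (butlast y)) (last y)" for y
  define t where "t y = p y * (ln (nx (butlast y) (last y)) - ln (nx (drop j (butlast y)) (last y)))" for y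
  have Suc_M: "Suc M = j + Suc k" using k by (simp add: j_def)
  \<comment> \<open>By stationarity the entropy with memory \<open>k\<close> may be computed on the
    last \<open>Suc k\<close> letters of a block of length \<open>Suc M\<close>, which puts both
    entropies on the same words.\<close>
  have "cond_entropy k = ex (j + Suc k) (\<lambda>y. - ln (nx (butlast (drop j y)) (last (drop j y))))"
    unfolding cond_entropy_def by (rule ex_drop[symmetric])
  also have "\<dots> = ex (Suc M) (\<lambda>y. - ln (nx (drop j (butlast y)) (last y)))"
    unfolding Suc_M by (rule ex_cong) (simp add: butlast_drop)
  finally have "cond_entropy k - cond_entropy M
      = ex (Suc M) (\<lambda>y. ln (nx (butlast y) (last y)) - ln (nx (drop j (butlast y)) (last y)))"
    unfolding cond_entropy_def[of M] by (simp flip: ex_diff)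
  then have sum_t: "(\<Sum>y\<in>words A (Suc M). t y) \<le> 0"
    using le by (simp add: t_def ex_def)
  have pos: "0 < p (butlast y)" "0 < nx (drop j (butlast y)) (last y)"
    if y: "set y \<subseteq> A" "length y = Suc M" "0 < p y" for y
  proof -
    show "0 < p (butlast y)" unfolding butlast_conv_take by (rule p_take_pos[OF y(1,3)])
    have "0 < nx (butlast (drop j y)) (last (drop j y))"
      using y k set_drop_subset[of j y] by (intro nx_butlast_last_pos p_drop_pos) (auto simp: j_def)
    then show "0 < nx (drop j (butlast y)) (last y)"
      using y k by (simp add: j_def butlast_drop)
  qed
  have t_eq: "t y = - p y * ln (q y / p y)" if y: "set y \<subseteq> A" "length y = Suc M" "0 < p y" for y
  proof -
    have "nx (butlast y) (last y) = p y / p (butlast y)"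
      using y by (cases y) (auto simp: nx_def)
    then show ?thesis
      using pos[OF y] y(3) by (simp add: t_def q_def ln_div ln_mult algebra_simps)
  qed
  have q_nonneg: "0 \<le> q y" for y by (simp add: q_def p_nonneg nx_nonneg)
  \<comment> \<open>Gibbs' inequality term by term, from \<open>ln s \<le> s - 1\<close> with
    \<open>s = q y / p y\<close>.\<close>
  have t_ge: "p y - q y \<le> t y" if y: "y \<in> words A (Suc M)" for y
  proof (cases "0 < p y")
    case True
    then have "0 < q y / p y" using pos[of y] y by (simp add: q_def)
    then have "ln (q y / p y) \<le> q y / p y - 1" by (rule ln_le_minus_one)
    then have "p y * ln (q y / p y) \<le> p y * (q y / p y - 1)" using True by (intro mult_left_mono) auto
    then show ?thesis using t_eq[of y] y True by (simp add: algebra_simps)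
  next
    case False
    then have "p y = 0" using p_nonneg[of y] by simp
    then show ?thesis using q_nonneg[of y] by (simp add: t_def)
  qed
  have "(\<Sum>y\<in>words A (Suc M). q y) = (\<Sum>w\<in>words A M. p w * (\<Sum>b\<in>A. nx (drop j w) b))"
    by (simp add: sum_words_snoc q_def sum_distrib_left)
  also have "\<dots> = (\<Sum>w\<in>words A M. p w)"
  proof (rule sum.cong[OF refl])
    fix w assume w: "w \<in> words A M"
    have "(\<Sum>b\<in>A. nx (drop j w) b) = 1" if "p w \<noteq> 0"
      using that w p_nonneg[of w] set_drop_subset[of j w] by (intro sum_nx p_drop_pos) auto
    then show "p w * (\<Sum>b\<in>A. nx (drop j w) b) = p w" by (cases "p w = 0") auto
  qed
  \<comment> \<open>Both \<open>p\<close> and \<open>q\<close> have total mass 1, so these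
    nonnegative terms have a nonpositive sum and all vanish. Equality in
    \<open>ln s \<le> s - 1\<close> then forces \<open>s = 1\<close>.\<close>
  finally have "(\<Sum>y\<in>words A (Suc M). t y - (p y - q y)) \<le> 0"
    using sum_t by (simp add: sum_subtractf sum_p_words)
  moreover have nonneg: "\<And>y. y \<in> words A (Suc M) \<Longrightarrow> 0 \<le> t y - (p y - q y)" using t_ge by force
  ultimately have sum_eq: "(\<Sum>y\<in>words A (Suc M). t y - (p y - q y)) = 0"
    using sum_nonneg[of "words A (Suc M)" "\<lambda>y. t y - (p y - q y)"] by force
  have eq: "t y = p y - q y" if "y \<in> words A (Suc M)" for y
    using sum_nonneg_eq_0_iff[THEN iffD1, OF finite_words_A nonneg sum_eq] that by fastforce
  define y where "y = w @ [b]"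
  have y: "set y \<subseteq> A" "length y = Suc M" using w b by (auto simp: y_def)
  have "p y = q y"
  proof (cases "0 < p y")
    case True
    then have "0 < q y / p y" using pos[of y] y by (simp add: q_def)
    moreover have "ln (q y / p y) = q y / p y - 1"
      using eq[of y] t_eq[of y] y True by (simp add: field_simps)
    ultimately have "q y / p y = 1" by (rule ln_eq_minus_one)
    then show ?thesis using True by simp
  next
    case False
    then have "p y = 0" using p_nonneg[of y] by simp
    then show ?thesis using eq[of y] y by (simp add: t_def)
  qed
  then show ?thesis by (simp add: y_def q_def j_def)
qed

end

context markov_law
begin

text \<open>Otherwise \<open>cond_entropy_gap\<close> says that after \<open>M\<close> letters only
  the last \<open>k\<close> matter for \<open>b\<close>. The Markov property extends this to longer
  words, and summing over extensions to the left extends it to shorter ones, against the choice of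
  \<open>w\<close> and \<open>b\<close>.\<close>

lemma cond_entropy_less:
  assumes k: "k \<le> M"
    and w: "set w \<subseteq> A" "b \<in> A" "k \<le> length w" "0 < p w" "nx w b \<noteq> nx (drop (length w - k) w) b"
  shows "cond_entropy M < cond_entropy k"
proof (rule ccontr)
  assume "\<not> cond_entropy M < cond_entropy k"
  then have eq: "p (v @ [b]) = p v * nx (drop (M - k) v) b" if "set v \<subseteq> A" "length v = M" for v
    using cond_entropy_gap[OF k _ that w(2)] by simp
  show False
  proof (cases "M \<le> length w")
    case True
    define v where "v = drop (length w - M) w"
    have v: "set v \<subseteq> A" "length v = M" "0 < p v"
      using w True p_drop_pos set_drop_subset[of "length w - M" w] by (auto simp: v_def)
    have "nx w b = nx v b" unfolding v_def using w True by (intro memory) auto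
    also have "\<dots> = nx (drop (M - k) v) b" using eq[OF v(1,2)] v(3) by (simp add: nx_def)
    also have "drop (M - k) v = drop (length w - k) w" using True k by (simp add: v_def)
    finally show False using w(5) by simp
  next
    case False
    define i where "i = M - length w"
    have "p (w @ [b]) = (\<Sum>u\<in>words A i. p (u @ w @ [b]))"
      using w by (intro sum_p_append_left[symmetric]) auto
    also have "\<dots> = (\<Sum>u\<in>words A i. p (u @ w) * nx (drop (length w - k) w) b)"
    proof (rule sum.cong[OF refl])
      fix u assume u: "u \<in> words A i"
      then have "p ((u @ w) @ [b]) = p (u @ w) * nx (drop (M - k) (u @ w)) b"
        using w False by (intro eq) (auto simp: i_def)
      moreover have "drop (M - k) (u @ w) = drop (length w - k) w"
        using u False w(3) k by (simp add: i_def)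
      ultimately show "p (u @ w @ [b]) = p (u @ w) * nx (drop (length w - k) w) b" by simp
    qed
    also have "\<dots> = p w * nx (drop (length w - k) w) b"
      using w by (simp add: sum_distrib_right[symmetric] sum_p_append_left)
    finally show False using w(4,5) by (simp add: nx_def)
  qed
qed

end

section \<open>Asymptotics of the likelihood and of the empirical entropies\<close>

context ergodic_markov_process
begin

text \<open>The chain rule: beyond the first \<open>M\<close> letters the log-likelihood is a sum of
  one function over successive blocks of length \<open>Suc M\<close>.\<close>

lemma ln_p_initial_word:
  assumes pos: "\<forall>n. 0 < p (initial_word X n \<omega>)" and \<omega>: "\<omega> \<in> space P"
  shows "ln (p (initial_word X (m + M) \<omega>)) = ln (p (initial_word X M \<omega>)) +
    (\<Sum>i<m. ln (nx (butlast (block X i (Suc M) \<omega>)) (last (block X i (Suc M) \<omega>))))"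
proof (induction m)
  case (Suc m)
  let ?x = "initial_word X (m + M) \<omega>" and ?b = "X (m + M) \<omega>"
  have x: "set ?x \<subseteq> A" "?b \<in> A" using set_initial_word[OF \<omega>] X_in_A[OF \<omega>] by auto
  have "p (initial_word X (Suc m + M) \<omega>) = p ?x * nx ?x ?b"
    using p_mult_nx[OF x] by (simp add: initial_word_Suc)
  moreover have "nx ?x ?b = nx (block X m M \<omega>) ?b"
    unfolding initial_word_append using x pos[rule_format, of "m + M"]
    by (intro memory_append) (auto simp: initial_word_append)
  ultimately have eq: "p (initial_word X (Suc m + M) \<omega>) = p ?x * nx (block X m M \<omega>) ?b" by simp
  have "0 < nx (block X m M \<omega>) ?b"
    using eq pos[rule_format, of "Suc m + M"] pos[rule_format, of "m + M"]
    by (simp add: zero_less_mult_iff)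
  then have "ln (p (initial_word X (Suc m + M) \<omega>)) = ln (p ?x) + ln (nx (block X m M \<omega>) ?b)"
    unfolding eq using pos[rule_format, of "m + M"] by (simp add: ln_mult)
  then show ?case using Suc by (simp add: block_Suc)
qed simp

text \<open>A Shannon-McMillan-Breiman theorem with a rate. Half of \<delta> pays for the
  fluctuation of the block sum, the other half for the path-dependent constant \<open>c\<close> from
  the first \<open>M\<close> letters.\<close>

lemma ln_p_rate:
  assumes "0 < \<delta>"
  shows "AE \<omega> in P. \<forall>\<^sub>F k in sequentially.
    \<bar>ln (p (initial_word X k \<omega>)) + real k * cond_entropy M\<bar> \<le> \<delta> * real k powr (3/4)"
proof -
  have "AE \<omega> in P. \<forall>\<^sub>F n in sequentially.
      \<bar>(\<Sum>i<n. - ln (nx (butlast (block X i (Suc M) \<omega>)) (last (block X i (Suc M) \<omega>)))) - real n * cond_entropy M\<bar>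
      \<le> \<delta> / 2 * real n powr (3/4)"
    unfolding cond_entropy_def by (rule block_sum_rate) (use assms in auto)
  then show ?thesis
    using AE_p_pos AE_space
  proof eventually_elim
    case (elim \<omega>)
    let ?h = "cond_entropy M"
    define c where "c = \<bar>ln (p (initial_word X M \<omega>))\<bar> + real M * ?h"
    from elim(1) obtain N where N: "\<And>n. N \<le> n \<Longrightarrow>
        \<bar>(\<Sum>i<n. - ln (nx (butlast (block X i (Suc M) \<omega>)) (last (block X i (Suc M) \<omega>)))) - real n * ?h\<bar>
        \<le> \<delta> / 2 * real n powr (3/4)"
      by (auto simp: eventually_sequentially)
    have "\<forall>\<^sub>F k in sequentially. c \<le> \<delta> / 2 * real k powr (3/4)"
      using assms by real_asymp
    then show ?case using eventually_ge_at_top[of "N + M"]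
    proof eventually_elim
      case (elim k)
      define m where "m = k - M"
      have k: "k = m + M" "N \<le> m" using elim(2) by (auto simp: m_def)
      let ?S = "\<Sum>i<m. ln (nx (butlast (block X i (Suc M) \<omega>)) (last (block X i (Suc M) \<omega>)))"
      have "ln (p (initial_word X k \<omega>)) + real k * ?h
          = ln (p (initial_word X M \<omega>)) + real M * ?h + (?S + real m * ?h)"
        using ln_p_initial_word[OF \<open>\<forall>n. 0 < p (initial_word X n \<omega>)\<close> \<open>\<omega> \<in> space P\<close>, of m]
        by (simp add: k algebra_simps)
      then have "\<bar>ln (p (initial_word X k \<omega>)) + real k * ?h\<bar> \<le> c + \<bar>?S + real m * ?h\<bar>"
        using mult_nonneg_nonneg[OF of_nat_0_le_iff cond_entropy_nonneg, of M M] unfolding c_def by linarith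
      also have "\<bar>?S + real m * ?h\<bar> \<le> \<delta> / 2 * real m powr (3/4)"
        using N[OF k(2)] abs_minus_cancel[of "?S + real m * ?h"] unfolding sum_negf minus_add_distrib
        by linarith
      also have "\<dots> \<le> \<delta> / 2 * real k powr (3/4)"
        using assms k by (intro mult_left_mono powr_mono2) auto
      also have "c \<le> \<delta> / 2 * real k powr (3/4)" by (rule elim(1))
      finally show ?case by simp
    qed
  qed
qed

lemma count_block_eq_0:
  assumes "\<forall>n. 0 < p (initial_word X n \<omega>)" "\<omega> \<in> space P" "p a = 0"
  shows "count_block (initial_word X n \<omega>) a = 0"
proof (cases "length a \<le> n")
  case True
  have "block X i (length a) \<omega> \<noteq> a" for i
    using p_block_pos[OF assms(1,2), of i "length a"] assms(3) by auto
  then have "real (count_block (initial_word X n \<omega>) a) = 0"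
    by (simp add: count_block_initial_word[OF True])
  then show ?thesis by simp
qed (simp add: count_block_def)

lemma butlast_initial_word: "butlast (initial_word X n \<omega>) = initial_word X (n - 1) \<omega>"
  by (cases n) (auto simp: initial_word_Suc initial_word_def)

text \<open>Block frequencies converge, and the entropy is continuous in them away from 0. Null
  words, where \<open>ln\<close> has no limit at hand, never occur on a good path and contribute
  exactly 0.\<close>

lemma emp_entropy_tendsto:
  "AE \<omega> in P. (\<lambda>n. emp_entropy A k (initial_word X n \<omega>)) \<longlonglongrightarrow> cond_entropy k"
proof -
  have freq: "AE \<omega> in P. \<forall>a\<in>words A l.
      (\<lambda>n. real (count_block (initial_word X n \<omega>) a) / real n) \<longlonglongrightarrow> p a" for l
    by (rule AE_finite_allI) (use block_frequency in auto)
  show ?thesis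
    using freq[of k] freq[of "Suc k"] AE_p_pos AE_space
  proof eventually_elim
    case (elim \<omega>)
    let ?x = "\<lambda>n. initial_word X n \<omega>"
    have lim: "(\<lambda>n. emp_prob (?x n) a * ln (emp_cond_prob (?x n) (butlast a) (last a)))
        \<longlonglongrightarrow> p a * ln (nx (butlast a) (last a))" if a: "a \<in> words A (Suc k)" for a
    proof (cases "p a = 0")
      case True
      then show ?thesis
        using count_block_eq_0[OF elim(3,4) True] by (simp add: emp_prob_def)
    next
      case False
      then have pa: "0 < p a" using p_nonneg[of a] by simp
      define w b where "w = butlast a" and "b = last a"
      have a_eq: "a = w @ [b]" using a by (cases a) (auto simp: w_def b_def)
      have w: "w \<in> words A k" using a by (auto simp: a_eq)
      have pw: "0 < p w" using pa p_append_le_left[of w "[b]"] a by (simp add: a_eq)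
      have ca: "(\<lambda>n. real (count_block (?x n) a) / real n) \<longlonglongrightarrow> p a" using elim(2) a by blast
      have cw: "(\<lambda>n. real (count_block (?x n) w) / real n) \<longlonglongrightarrow> p w" using elim(1) w by blast
      have "(\<lambda>n. real n / (real n + 1 - real (length a))) \<longlonglongrightarrow> 1" by real_asymp
      from tendsto_mult[OF ca this]
      have "(\<lambda>n. real (count_block (?x n) a) / real n * (real n / (real n + 1 - real (length a)))) \<longlonglongrightarrow> p a"
        by simp
      then have 1: "(\<lambda>n. emp_prob (?x n) a) \<longlonglongrightarrow> p a"
        by (rule Lim_transform_eventually)
          (use eventually_gt_at_top[of 0] in eventually_elim, simp add: emp_prob_def)
      \<comment> \<open>The denominator of the empirical conditional probability is a count in the
        word without its last letter, hence the shift to \<open>n - 1\<close>.\<close>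
      have "(\<lambda>n. real (count_block (?x (n - 1)) w) / real (n - 1)) \<longlonglongrightarrow> p w"
        using filterlim_compose[OF cw filterlim_minus_const_nat_at_top[of 1]] .
      moreover have "(\<lambda>n. real (n - 1) / real n) \<longlonglongrightarrow> 1"
      proof (rule Lim_transform_eventually)
        show "(\<lambda>n. (real n - 1) / real n) \<longlonglongrightarrow> 1" by real_asymp
        show "\<forall>\<^sub>F n in sequentially. (real n - 1) / real n = real (n - 1) / real n"
          using eventually_ge_at_top[of 1] by eventually_elim (simp add: of_nat_diff)
      qed
      ultimately have "(\<lambda>n. real (count_block (?x (n - 1)) w) / real (n - 1) * (real (n - 1) / real n)) \<longlonglongrightarrow> p w * 1"
        by (rule tendsto_mult)
      then have "(\<lambda>n. real (count_block (?x n) a) / real n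
          / (real (count_block (?x (n - 1)) w) / real (n - 1) * (real (n - 1) / real n))) \<longlonglongrightarrow> p a / (p w * 1)"
        using pw by (intro tendsto_divide ca) auto
      then have "(\<lambda>n. emp_cond_prob (?x n) w b) \<longlonglongrightarrow> p a / (p w * 1)"
        by (rule Lim_transform_eventually)
          (use eventually_gt_at_top[of 1] in eventually_elim, simp add: emp_cond_prob_def butlast_initial_word a_eq)
      then have "(\<lambda>n. ln (emp_cond_prob (?x n) w b)) \<longlonglongrightarrow> ln (nx w b)"
        using pw pa by (intro tendsto_ln) (auto simp: nx_def a_eq)
      then show ?thesis using tendsto_mult[OF 1] by (simp add: w_def b_def)
    qed
    have "(\<lambda>n. - (\<Sum>a\<in>words A (Suc k). emp_prob (?x n) a * ln (emp_cond_prob (?x n) (butlast a) (last a))))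
        \<longlonglongrightarrow> - (\<Sum>a\<in>words A (Suc k). p a * ln (nx (butlast a) (last a)))"
      by (intro tendsto_minus tendsto_sum lim)
    then show ?case
      unfolding emp_entropy_def cond_entropy_def ex_def by (simp add: words_def sum_negf)
  qed
qed

lemma sum_count_block:
  assumes "l \<le> n" "\<omega> \<in> space P"
  shows "(\<Sum>a\<in>words A l. real (count_block (initial_word X n \<omega>) a) * F a) = (\<Sum>i<n + 1 - l. F (block X i l \<omega>))"
proof -
  have "(\<Sum>a\<in>words A l. real (count_block (initial_word X n \<omega>) a) * F a)
      = (\<Sum>a\<in>words A l. \<Sum>i<n + 1 - l. of_bool (block X i l \<omega> = a) * F a)"
  proof (rule sum.cong[OF refl])
    fix a assume "a \<in> words A l"
    then show "real (count_block (initial_word X n \<omega>) a) * F a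
        = (\<Sum>i<n + 1 - l. of_bool (block X i l \<omega> = a) * F a)"
      using count_block_initial_word[of a n \<omega>] assms(1) by (simp add: sum_distrib_right)
  qed
  also have "\<dots> = (\<Sum>i<n + 1 - l. \<Sum>a\<in>words A l. of_bool (block X i l \<omega> = a) * F a)"
    by (rule sum.swap)
  also have "\<dots> = (\<Sum>i<n + 1 - l. F (block X i l \<omega>))"
  proof (rule sum.cong[OF refl])
    fix i
    have "(\<Sum>a\<in>words A l. of_bool (block X i l \<omega> = a) * F a)
        = (\<Sum>a\<in>words A l. if block X i l \<omega> = a then F a else 0)"
      by (rule sum.cong) auto
    also have "\<dots> = F (block X i l \<omega>)"
      using set_block[OF assms(2)] by (subst sum.delta') auto
    finally show "(\<Sum>a\<in>words A l. of_bool (block X i l \<omega> = a) * F a) = F (block X i l \<omega>)" .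
  qed
  finally show ?thesis .
qed

text \<open>The empirical transition probabilities maximise the likelihood, so the empirical entropy is
  at most the cross entropy with respect to the true ones.\<close>

lemma emp_entropy_le_cross_entropy:
  assumes n: "k < n" and pos: "\<forall>n. 0 < p (initial_word X n \<omega>)" and \<omega>: "\<omega> \<in> space P"
  shows "emp_entropy A k (initial_word X n \<omega>)
    \<le> (\<Sum>i<n - k. - ln (nx (butlast (block X i (Suc k) \<omega>)) (last (block X i (Suc k) \<omega>)))) / real (n - k)"
proof -
  define x where "x = initial_word X n \<omega>"
  define N where "N a = real (count_block x a)" for a
  define N' where "N' w = real (count_block (butlast x) w)" for w
  \<comment> \<open>Each occurrence of \<open>w\<close> before the last letter is followed by
    exactly one letter; counting in \<open>butlast x\<close> makes the empirical transition
    probabilities sum to 1.\<close>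
  have N_snoc: "(\<Sum>b\<in>A. N (w @ [b])) = N' w" if w: "w \<in> words A k" for w
  proof -
    have "(\<Sum>b\<in>A. N (w @ [b])) = (\<Sum>b\<in>A. \<Sum>i<n - k. of_bool (block X i k \<omega> = w) * of_bool (X (i + k) \<omega> = b))"
    proof (rule sum.cong[OF refl])
      fix b
      have "N (w @ [b]) = (\<Sum>i<n - k. of_bool (block X i (Suc k) \<omega> = w @ [b]))"
        unfolding N_def x_def using w n by (subst count_block_initial_word) simp_all
      also have "\<dots> = (\<Sum>i<n - k. of_bool (block X i k \<omega> = w) * of_bool (X (i + k) \<omega> = b))"
        by (rule sum.cong) (auto simp: block_Suc)
      finally show "N (w @ [b]) = (\<Sum>i<n - k. of_bool (block X i k \<omega> = w) * of_bool (X (i + k) \<omega> = b))" .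
    qed
    also have "\<dots> = (\<Sum>i<n - k. \<Sum>b\<in>A. of_bool (block X i k \<omega> = w) * of_bool (X (i + k) \<omega> = b))"
      by (rule sum.swap)
    also have "\<dots> = (\<Sum>i<n - k. of_bool (block X i k \<omega> = w))"
    proof (rule sum.cong[OF refl])
      fix i
      have "(\<Sum>b\<in>A. of_bool (block X i k \<omega> = w) * of_bool (X (i + k) \<omega> = b))
          = (\<Sum>b\<in>A. if X (i + k) \<omega> = b then of_bool (block X i k \<omega> = w) else 0 :: real)"
        by (rule sum.cong) auto
      also have "\<dots> = of_bool (block X i k \<omega> = w)"
        using X_in_A[OF \<omega>] fin_A by (subst sum.delta') auto
      finally show "(\<Sum>b\<in>A. of_bool (block X i k \<omega> = w) * of_bool (X (i + k) \<omega> = b))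
          = (of_bool (block X i k \<omega> = w) :: real)" .
    qed
    also have "\<dots> = N' w"
      unfolding N'_def x_def butlast_initial_word using w n
      by (subst count_block_initial_word) auto
    finally show ?thesis .
  qed
  \<comment> \<open>Again \<open>ln s \<le> s - 1\<close>, now with \<open>s\<close> the ratio of
    true to empirical transition probability, weighted by the counts.\<close>
  have "(\<Sum>a\<in>words A (Suc k). N a * (ln (nx (butlast a) (last a)) - ln (N a / N' (butlast a))))
      \<le> (\<Sum>a\<in>words A (Suc k). nx (butlast a) (last a) * N' (butlast a) - N a)"
  proof (rule sum_mono)
    fix a assume a: "a \<in> words A (Suc k)"
    define w b where "w = butlast a" and "b = last a"
    have a_eq: "a = w @ [b]" using a by (cases a) (auto simp: w_def b_def)
    have wb: "w \<in> words A k" "b \<in> A" using a by (auto simp: a_eq)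
    show "N a * (ln (nx (butlast a) (last a)) - ln (N a / N' (butlast a)))
        \<le> nx (butlast a) (last a) * N' (butlast a) - N a"
    proof (cases "N a = 0")
      case True
      then show ?thesis by (simp add: nx_nonneg N'_def)
    next
      case False
      then have Na: "0 < N a" by (simp add: N_def)
      have "p a \<noteq> 0" using count_block_eq_0[OF pos \<omega>, of a n] Na by (auto simp: N_def x_def)
      then have "0 < p a" using p_nonneg[of a] by simp
      then have nx: "0 < nx w b"
        using nx_butlast_last_pos[of a] a unfolding w_def b_def by fastforce
      have "N a \<le> N' w"
        unfolding N_snoc[OF wb(1), symmetric] a_eq using wb(2) fin_A
        by (intro member_le_sum) (auto simp: N_def)
      then have N'w: "0 < N' w" using Na by simp
      have "ln (nx w b) - ln (N a / N' w) = ln (nx w b * N' w / N a)"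
        using Na N'w nx by (simp add: ln_div ln_mult)
      also have "\<dots> \<le> nx w b * N' w / N a - 1"
        using Na N'w nx by (intro ln_le_minus_one) auto
      finally have "N a * (ln (nx w b) - ln (N a / N' w)) \<le> N a * (nx w b * N' w / N a - 1)"
        using Na by (intro mult_left_mono) auto
      then show ?thesis using Na by (simp add: w_def b_def algebra_simps)
    qed
  qed
  also have "\<dots> = (\<Sum>w\<in>words A k. N' w * (\<Sum>b\<in>A. nx w b) - (\<Sum>b\<in>A. N (w @ [b])))"
    by (simp add: sum_words_snoc sum_subtractf sum_distrib_left mult.commute)
  also have "\<dots> \<le> 0"
  proof (rule sum_nonpos)
    fix w assume w: "w \<in> words A k"
    \<comment> \<open>The sum is 1, except after a null word, where division by zero makes it
      0.\<close>
    have "(\<Sum>b\<in>A. nx w b) \<le> 1"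
    proof (cases "p w = 0")
      case True
      then show ?thesis by (simp add: nx_def)
    next
      case False
      then show ?thesis using sum_nx[of w] w p_nonneg[of w] by simp
    qed
    then have "N' w * (\<Sum>b\<in>A. nx w b) \<le> N' w"
      using mult_left_mono[of _ 1 "N' w"] by (simp add: N'_def)
    then show "N' w * (\<Sum>b\<in>A. nx w b) - (\<Sum>b\<in>A. N (w @ [b])) \<le> 0"
      using N_snoc[OF w] by simp
  qed
  finally have gibbs: "- (\<Sum>a\<in>words A (Suc k). N a * ln (N a / N' (butlast a)))
      \<le> (\<Sum>a\<in>words A (Suc k). N a * - ln (nx (butlast a) (last a)))"
    by (simp add: right_diff_distrib sum_subtractf sum_negf)
  have "emp_entropy A k x = - (\<Sum>a\<in>words A (Suc k). N a * ln (N a / N' (butlast a))) / real (n - k)"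
  proof -
    have "emp_entropy A k x = - (\<Sum>a\<in>words A (Suc k). N a * ln (N a / N' (butlast a)) / real (n - k))"
      unfolding emp_entropy_def
    proof (intro arg_cong[where f = uminus] sum.cong)
      fix a assume a: "a \<in> words A (Suc k)"
      then have "butlast a @ [last a] = a" by (cases a) auto
      then show "emp_prob x a * ln (emp_cond_prob x (butlast a) (last a)) = N a * ln (N a / N' (butlast a)) / real (n - k)"
        using a n by (simp add: emp_prob_def emp_cond_prob_def N_def N'_def x_def of_nat_diff)
    qed (simp add: words_def)
    then show ?thesis by (simp add: sum_divide_distrib)
  qed
  also have "\<dots> \<le> (\<Sum>a\<in>words A (Suc k). N a * - ln (nx (butlast a) (last a))) / real (n - k)"
    using gibbs by (intro divide_right_mono) auto
  also have "(\<Sum>a\<in>words A (Suc k). N a * - ln (nx (butlast a) (last a)))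
      = (\<Sum>i<n - k. - ln (nx (butlast (block X i (Suc k) \<omega>)) (last (block X i (Suc k) \<omega>))))"
    unfolding N_def x_def using n \<omega> by (subst sum_count_block) auto
  finally show ?thesis by (simp add: x_def)
qed

text \<open>The cross entropy is an average of \<open>n - M\<close> block terms with error
  \<open>(n - M) powr (-1/4)\<close>, far below the logarithmic rate. This uses one of the two terms
  \<open>ln n powr (-1/4)\<close> in the threshold.\<close>

lemma emp_entropy_upper:
  "AE \<omega> in P. \<forall>\<^sub>F n in sequentially.
    emp_entropy A M (initial_word X n \<omega>) \<le> cond_entropy M + ln (real n) powr (-1/4)"
proof -
  have "AE \<omega> in P. \<forall>\<^sub>F n in sequentially.
      \<bar>(\<Sum>i<n. - ln (nx (butlast (block X i (Suc M) \<omega>)) (last (block X i (Suc M) \<omega>)))) - real n * cond_entropy M\<bar>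
      \<le> 1 * real n powr (3/4)"
    unfolding cond_entropy_def by (rule block_sum_rate) auto
  then show ?thesis
    using AE_p_pos AE_space
  proof eventually_elim
    case (elim \<omega>)
    let ?h = "cond_entropy M"
    let ?S = "\<lambda>n. \<Sum>i<n. - ln (nx (butlast (block X i (Suc M) \<omega>)) (last (block X i (Suc M) \<omega>)))"
    from elim(1) obtain N where N: "\<And>n. N \<le> n \<Longrightarrow> \<bar>?S n - real n * ?h\<bar> \<le> real n powr (3/4)"
      by (auto simp: eventually_sequentially)
    have "\<forall>\<^sub>F n in sequentially. (real n - real M) powr (-1/4) \<le> ln (real n) powr (-1/4)"
      by real_asymp
    then show ?case using eventually_gt_at_top[of "N + M"]
    proof eventually_elim
      case (elim n)
      define m where "m = n - M"
      have m: "N \<le> m" "0 < m" "M < n" using elim(2) by (auto simp: m_def)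
      have "emp_entropy A M (initial_word X n \<omega>) \<le> ?S m / real m"
        unfolding m_def using \<open>\<forall>n. 0 < p (initial_word X n \<omega>)\<close> \<open>\<omega> \<in> space P\<close> m
        by (intro emp_entropy_le_cross_entropy)
      also have "?S m \<le> real m * ?h + real m powr (3/4)" using N[OF m(1)] by linarith
      then have "?S m / real m \<le> (real m * ?h + real m powr (3/4)) / real m"
        by (rule divide_right_mono) simp
      also have "\<dots> = ?h + real m powr (3/4) / real m powr 1" using m(2) by (simp add: add_divide_distrib)
      also have "real m powr (3/4) / real m powr 1 = real m powr (-1/4)"
        by (simp only: powr_diff[symmetric]) simp
      also have "real m = real n - real M" using m by (simp add: m_def of_nat_diff)
      finally show ?case using elim(1) by simp
    qed
  qed
qed

end

section \<open>Repetition times\<close>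

lemma repeat_length_set:
  fixes x :: "'a list"
  defines "R \<equiv> {k. \<exists>r. k \<le> r \<and> r + k \<le> length x \<and> take k (drop r x) = take k x}"
  shows "finite R" "R \<noteq> {}"
proof -
  have "R \<subseteq> {..length x}" by (auto simp: R_def)
  then show "finite R" by (rule finite_subset) simp
  have "0 \<in> R" by (auto simp: R_def)
  then show "R \<noteq> {}" by blast
qed

lemma repeat_length_ge:
  assumes "k \<le> r" "r + k \<le> length x" "take k (drop r x) = take k x"
  shows "k \<le> repeat_length x"
  unfolding repeat_length_def by (rule Max_ge[OF repeat_length_set(1)]) (use assms in blast)

lemma repeat_length_witness:
  obtains r where "repeat_length x \<le> r" "r + repeat_length x \<le> length x"
    "take (repeat_length x) (drop r x) = take (repeat_length x) x"
  using Max_in[OF repeat_length_set[of x]] unfolding repeat_length_def[symmetric] by blast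

context markov_law
begin

text \<open>With \<open>v\<close> the first \<open>M\<close> letters of \<open>w\<close>,
  \<open>p_chain\<close> gives \<open>p (u @ w) = p (u @ v) * p w / p v\<close>, so dependence on
  the past costs at most a factor \<open>1 / p v\<close>.\<close>

lemma p_append_le:
  obtains C where "0 \<le> C"
    "\<And>u w. set u \<subseteq> A \<Longrightarrow> set w \<subseteq> A \<Longrightarrow> M \<le> length w \<Longrightarrow> p (u @ w) \<le> C * p u * p w"
proof -
  \<comment> \<open>A null \<open>v\<close> contributes \<open>1 / 0 = 0\<close> here; for such
    \<open>v\<close> the left-hand side vanishes too.\<close>
  define C where "C = (\<Sum>v\<in>words A M. 1 / p v)"
  have C: "0 \<le> C" unfolding C_def by (intro sum_nonneg) (simp add: p_nonneg)
  have "p (u @ w) \<le> C * p u * p w" if u: "set u \<subseteq> A" and w: "set w \<subseteq> A" "M \<le> length w" for u w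
  proof -
    define v z where "v = take M w" and "z = drop M w"
    have vz: "w = v @ z" "length v = M" "set v \<subseteq> A" "set z \<subseteq> A"
      using w set_take_subset[of M w] set_drop_subset[of M w] by (auto simp: v_def z_def)
    show ?thesis
    proof (cases "p v = 0")
      case True
      have "p (u @ w) \<le> p w" by (rule p_append_le_right[OF u w(1)])
      also have "p w \<le> 0" using p_append_le_left[of v z] vz True by simp
      finally show ?thesis using C p_nonneg[of u] p_nonneg[of w] by (meson mult_nonneg_nonneg order.trans)
    next
      case False
      then have v: "0 < p v" using p_nonneg[of v] by simp
      have "1 / p v \<le> C"
        unfolding C_def using vz p_nonneg by (intro member_le_sum) auto
      have "p (u @ w) * p v = p (u @ v) * p w"
        using p_chain[of v u z] vz u by simp
      also have "\<dots> \<le> p u * p w"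
        using p_append_le_left[of u v] u vz p_nonneg by (intro mult_right_mono) auto
      finally have "p (u @ w) \<le> (1 / p v) * (p u * p w)"
        using v by (simp add: field_simps)
      also have "\<dots> \<le> C * (p u * p w)"
        using \<open>1 / p v \<le> C\<close> p_nonneg by (intro mult_right_mono) auto
      finally show ?thesis by (simp add: mult.assoc)
    qed
  qed
  then show ?thesis using C that by blast
qed

end

section \<open>Return times of the initial block and bounds on the threshold\<close>

context ergodic_markov_process
begin

text \<open>Since \<open>k \<le> r\<close> the two copies do not overlap: the first \<open>r\<close>
  letters determine the word that has to follow, and \<open>p_append_le\<close> bounds its
  conditional probability by \<open>C * b\<close>.\<close>

lemma prob_repeat_le:
  obtains C where "0 \<le> C"
    "\<And>k r b. M \<le> k \<Longrightarrow> k \<le> r \<Longrightarrow> 0 \<le> b \<Longrightarrow>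
      prob {\<omega> \<in> space P. p (initial_word X k \<omega>) \<le> b \<and> block X r k \<omega> = initial_word X k \<omega>} \<le> C * b"
proof -
  obtain C where C: "0 \<le> C" and app:
    "\<And>u w. set u \<subseteq> A \<Longrightarrow> set w \<subseteq> A \<Longrightarrow> M \<le> length w \<Longrightarrow> p (u @ w) \<le> C * p u * p w"
    using p_append_le by blast
  have "prob {\<omega> \<in> space P. p (initial_word X k \<omega>) \<le> b \<and> block X r k \<omega> = initial_word X k \<omega>} \<le> C * b"
    if k: "M \<le> k" "k \<le> r" and b: "0 \<le> b" for k r b
  proof -
    define Q where "Q x \<longleftrightarrow> p (take k x) \<le> b \<and> drop r x = take k x" for x
    have "initial_word X k \<omega> = take k (initial_word X (r + k) \<omega>)" for \<omega>
      by (simp add: take_initial_word)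
    moreover have "block X r k \<omega> = drop r (initial_word X (r + k) \<omega>)" for \<omega>
      by (simp add: initial_word_append)
    ultimately have "prob {\<omega> \<in> space P. p (initial_word X k \<omega>) \<le> b \<and> block X r k \<omega> = initial_word X k \<omega>}
        = prob {\<omega> \<in> space P. Q (initial_word X (r + k) \<omega>)}"
      by (simp add: Q_def)
    also have "\<dots> = (\<Sum>u\<in>words A r. \<Sum>v\<in>words A k. p (u @ v) * of_bool (Q (u @ v)))"
      unfolding prob_initial_word ex_def by (rule sum_words_append)
    also have "\<dots> \<le> (\<Sum>u\<in>words A r. p u * (C * b))"
    proof (rule sum_mono)
      fix u assume u: "u \<in> words A r"
      define w where "w = take k u"
      have w: "w \<in> words A k" using u k set_take_subset[of k u] by (auto simp: w_def)
      have "(\<Sum>v\<in>words A k. p (u @ v) * of_bool (Q (u @ v)))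
          = (\<Sum>v\<in>words A k. if v = w then p (u @ w) * of_bool (p w \<le> b) else 0)"
        using u k by (intro sum.cong) (auto simp: Q_def w_def)
      also have "\<dots> = p (u @ w) * of_bool (p w \<le> b)"
        using w by (subst sum.delta) auto
      also have "\<dots> \<le> p u * (C * b)"
      proof (cases "p w \<le> b")
        case True
        have "p (u @ w) \<le> C * p u * p w" using u w k by (intro app) auto
        also have "\<dots> \<le> C * p u * b" using True C p_nonneg by (intro mult_left_mono) auto
        finally show ?thesis using True by (simp add: mult_ac)
      qed (use C b p_nonneg in simp)
      finally show "(\<Sum>v\<in>words A k. p (u @ v) * of_bool (Q (u @ v))) \<le> p u * (C * b)" .
    qed
    also have "\<dots> = C * b" by (simp add: sum_distrib_right[symmetric] sum_p_words)
    finally show ?thesis .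
  qed
  then show ?thesis using C that by blast
qed

lemma sets_repeat:
  "{\<omega> \<in> space P. R (initial_word X k \<omega>) \<and> block X r k \<omega> = initial_word X k \<omega>} \<in> events"
proof -
  have "{\<omega> \<in> space P. R (initial_word X k \<omega>) \<and> block X r k \<omega> = initial_word X k \<omega>}
      = (\<Union>w\<in>{w \<in> words A k. R w}. {\<omega> \<in> space P. initial_word X k \<omega> = w} \<inter> {\<omega> \<in> space P. block X r k \<omega> = w})"
    using set_initial_word by auto
  also have "\<dots> \<in> events"
    by (intro sets.finite_UN sets.Int sets_block_eq sets_initial_word) simp
  finally show ?thesis .
qed

text \<open>A union bound over the times \<open>r\<close>, followed by Borel-Cantelli. The bound on
  the likelihood of the initial block, needed for \<open>prob_repeat_le\<close>, holds eventually by
  \<open>ln_p_rate\<close>.\<close>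

lemma no_early_repeat:
  assumes h: "h = cond_entropy M" and \<delta>: "0 < \<delta>"
  shows "AE \<omega> in P. \<forall>\<^sub>F k in sequentially. \<forall>r\<ge>k.
    real r \<le> exp (real k * h - 2 * \<delta> * real k powr (3/4)) \<longrightarrow> block X r k \<omega> \<noteq> initial_word X k \<omega>"
proof -
  obtain C where C: "0 \<le> C" and rep:
    "\<And>k r b. M \<le> k \<Longrightarrow> k \<le> r \<Longrightarrow> 0 \<le> b \<Longrightarrow>
      prob {\<omega> \<in> space P. p (initial_word X k \<omega>) \<le> b \<and> block X r k \<omega> = initial_word X k \<omega>} \<le> C * b"
    using prob_repeat_le by blast
  \<comment> \<open>\<open>b k\<close> is the upper bound on the likelihood from
    \<open>ln_p_rate\<close>. The horizon \<open>N k\<close> gives up \<delta> once more, so that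
    \<open>N k * b k\<close> is summable.\<close>
  define b where "b k = exp (- real k * h + \<delta> * real k powr (3/4))" for k
  define N where "N k = exp (real k * h - 2 * \<delta> * real k powr (3/4))" for k
  define D where "D k r = {\<omega> \<in> space P. p (initial_word X k \<omega>) \<le> b k \<and> block X r k \<omega> = initial_word X k \<omega>}" for k r
  define I where "I k = {r. k \<le> r \<and> real r \<le> N k}" for k
  have I_sub: "I k \<subseteq> {k..nat \<lfloor>N k\<rfloor>}" for k by (auto simp: I_def le_nat_floor)
  then have fin_I: "finite (I k)" for k by (rule finite_subset) simp
  define E where "E k = (\<Union>r\<in>I k. D k r)" for k
  have D_events: "D k r \<in> events" for k r unfolding D_def by (rule sets_repeat)
  then have E_events: "E k \<in> events" for k unfolding E_def using fin_I by blast
  have E_le: "prob (E k) \<le> C * exp (- \<delta> * real k powr (3/4))" if k: "M + 1 \<le> k" for k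
  proof -
    have "prob (E k) \<le> (\<Sum>r\<in>I k. prob (D k r))"
      unfolding E_def using D_events fin_I by (intro finite_measure_subadditive_finite) auto
    also have "\<dots> \<le> (\<Sum>r\<in>I k. C * b k)"
      unfolding D_def using k by (intro sum_mono rep) (auto simp: I_def b_def)
    also have "\<dots> = real (card (I k)) * (C * b k)" by simp
    also have "\<dots> \<le> N k * (C * b k)"
    proof (rule mult_right_mono)
      have "card (I k) \<le> card {k..nat \<lfloor>N k\<rfloor>}" by (rule card_mono[OF _ I_sub]) simp
      also have "\<dots> \<le> nat \<lfloor>N k\<rfloor>" using k by simp
      finally have "real (card (I k)) \<le> real (nat \<lfloor>N k\<rfloor>)" by simp
      also have "\<dots> \<le> N k" by (rule of_nat_floor) (simp add: N_def)
      finally show "real (card (I k)) \<le> N k" .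
    qed (use C in \<open>simp add: b_def\<close>)
    also have "\<dots> = C * (N k * b k)" by simp
    also have "N k * b k = exp (- \<delta> * real k powr (3/4))"
      unfolding N_def b_def by (simp flip: exp_add)
    finally show ?thesis .
  qed
  have "summable (\<lambda>k. prob (E k))"
  proof (rule summable_comparison_test_ev)
    show "summable (\<lambda>k. C * real k powr (-2))"
      by (intro summable_mult) (simp add: summable_real_powr_iff)
    have "\<forall>\<^sub>F k in sequentially. exp (- \<delta> * real k powr (3/4)) \<le> real k powr (-2)"
      using \<delta> by real_asymp
    then show "\<forall>\<^sub>F k in sequentially. norm (prob (E k)) \<le> C * real k powr (-2)"
      using eventually_ge_at_top[of "M + 1"]
    proof eventually_elim
      case (elim k)
      then show ?case using E_le[of k] mult_left_mono[OF elim(1) C] by simp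
    qed
  qed
  then have "AE \<omega> in P. \<forall>\<^sub>F k in sequentially. \<omega> \<in> space P - E k"
    by (intro borel_cantelli_AE1 E_events) (auto simp: emeasure_eq_measure)
  then show ?thesis
    using ln_p_rate[OF \<delta>] AE_p_pos AE_space
  proof eventually_elim
    case (elim \<omega>)
    note pos = elim(3) and \<omega> = elim(4)
    from elim(1,2) show ?case
    proof eventually_elim
      case (elim k)
      have "ln (p (initial_word X k \<omega>)) \<le> - real k * h + \<delta> * real k powr (3/4)"
        using elim(2) h by simp
      then have "exp (ln (p (initial_word X k \<omega>))) \<le> b k" by (simp add: b_def)
      then have "p (initial_word X k \<omega>) \<le> b k" using pos by simp
      then show ?case using elim(1) \<omega> by (auto simp: E_def D_def I_def N_def)
    qed
  qed
qed

text \<open>If the initial block of length \<open>l\<close> repeats within \<open>n\<close> letters,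
  \<open>no_early_repeat\<close> gives \<open>l * h - 2 * \<delta> * l powr (3/4) < ln n\<close>.
  Dividing by \<open>l\<close>, the shortfall of \<open>ln n / l\<close> below \<open>h\<close> is
  at most one of the two correction terms.\<close>

lemma entropy_threshold_lower:
  "AE \<omega> in P. \<forall>\<^sub>F n in sequentially.
    ereal (cond_entropy M + ln (real n) powr (-1/4)) \<le> entropy_threshold (initial_word X n \<omega>)"
proof -
  define h where "h = cond_entropy M"
  show ?thesis
  \<comment> \<open>For \<open>h = 0\<close> the quotient \<open>ln n / l\<close> need only be
    nonnegative; the correction terms do the rest.\<close>
  proof (cases "h = 0")
    case True
    have "ereal (cond_entropy M + ln (real n) powr (-1/4)) \<le> entropy_threshold (initial_word X n \<omega>)"
      if "1 \<le> n" for n \<omega>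
      using True that by (auto simp: entropy_threshold_def h_def)
    then show ?thesis by (intro AE_I2 eventually_mono[OF eventually_ge_at_top[of 1]])
  next
    case False
    then have h: "0 < h" using cond_entropy_nonneg[of M] by (simp add: h_def)
    \<comment> \<open>Chosen so that \<open>2 * \<delta> * h powr (1/4) = 1\<close>, which turns the
      error at length \<open>L / h\<close> into exactly \<open>L powr (-1/4)\<close>.\<close>
    define \<delta> where "\<delta> = 1 / (2 * h powr (1/4))"
    have \<delta>: "0 < \<delta>" using h by (simp add: \<delta>_def)
    show ?thesis
      using no_early_repeat[OF h_def \<delta>]
    proof eventually_elim
      case (elim \<omega>)
      then obtain K where K: "\<And>k r. K \<le> k \<Longrightarrow> k \<le> r \<Longrightarrow>
          real r \<le> exp (real k * h - 2 * \<delta> * real k powr (3/4)) \<Longrightarrow> block X r k \<omega> \<noteq> initial_word X k \<omega>"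
        by (auto simp: eventually_sequentially)
      have "\<forall>\<^sub>F n in sequentially. real K \<le> ln (real n) / h" using h by real_asymp
      then show ?case using eventually_ge_at_top[of 2]
      proof eventually_elim
        case (elim n)
        define x where "x = initial_word X n \<omega>"
        define l where "l = repeat_length x"
        define L where "L = ln (real n)"
        have L: "0 < L" using elim(2) by (simp add: L_def)
        have "h + L powr (-1/4) \<le> L / real l + 2 * L powr (-1/4)" if l: "0 < l"
        \<comment> \<open>In the other case \<open>l\<close> exceeds \<open>L / h\<close>: it is
          large enough for the asymptotic bound, and \<open>l powr (-1/4)\<close> is controlled by
          \<open>L\<close>.\<close>
        proof (cases "h \<le> L / real l")
          case True
          moreover have "0 \<le> L powr (-1/4)" by simp
          ultimately show ?thesis by linarith
        next
          case False
          then have Ll: "L / h < real l" using l h by (simp add: field_simps)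
          then have Kl: "K \<le> l" using elim(1) by (simp add: L_def)
          obtain r where r: "l \<le> r" "r + l \<le> length x" "take l (drop r x) = take l x"
            unfolding l_def by (rule repeat_length_witness)
          then have "block X r l \<omega> = initial_word X l \<omega>"
            by (simp add: x_def take_drop_initial_word take_initial_word)
          then have "exp (real l * h - 2 * \<delta> * real l powr (3/4)) < real r"
            using K[OF Kl r(1)] by fastforce
          also have "real r \<le> exp L" using r(2) elim(2) by (simp add: x_def L_def)
          finally have "real l * h - 2 * \<delta> * real l powr (3/4) < L" by simp
          then have "(real l * h - 2 * \<delta> * real l powr (3/4)) / real l < L / real l"
            using l by (intro divide_strict_right_mono) auto
          also have "(real l * h - 2 * \<delta> * real l powr (3/4)) / real l
              = h - 2 * \<delta> * (real l powr (3/4) / real l powr 1)"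
            using l by (simp add: diff_divide_distrib)
          also have "real l powr (3/4) / real l powr 1 = real l powr (-1/4)"
            by (simp only: powr_diff[symmetric]) simp
          finally have 1: "h - 2 * \<delta> * real l powr (-1/4) < L / real l" .
          have "real l powr (-1/4) \<le> (L / h) powr (-1/4)"
            using Ll L h by (intro powr_mono2') auto
          also have "\<dots> = h powr (1/4) * L powr (-1/4)"
            using L h by (simp add: powr_divide powr_minus_divide)
          finally have "2 * \<delta> * real l powr (-1/4) \<le> 2 * \<delta> * (h powr (1/4) * L powr (-1/4))"
            using \<delta> by (intro mult_left_mono) auto
          also have "\<dots> = L powr (-1/4)" using h by (simp add: \<delta>_def)
          finally show ?thesis using 1 by simp
        qed
        then show ?case
          by (simp add: entropy_threshold_def l_def[symmetric] x_def[symmetric] h_def[symmetric] L_def[symmetric])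
            (simp add: x_def L_def)
      qed
    qed
  qed
qed

text \<open>If \<open>w\<close> occurs at time \<open>i\<close> but at none of the times \<open>i + k, \<dots>, i + N\<close>, then within a window of
  length \<open>N\<close> such \<open>i\<close> are less than \<open>k\<close> apart. Stationarity turns this count into a probability.\<close>

lemma prob_no_return_le:
  assumes w: "set w \<subseteq> A" "length w = k" and k: "0 < k" and N: "0 < N"
  shows "prob {\<omega> \<in> space P. initial_word X k \<omega> = w \<and> (\<forall>r\<in>{k..N}. block X r k \<omega> \<noteq> w)} \<le> real k / real N"
proof -
  define Q where "Q u \<longleftrightarrow> take k u = w \<and> (\<forall>r\<in>{k..N}. take k (drop r u) \<noteq> w)" for u
  define q where "q = prob {\<omega> \<in> space P. Q (block X 0 (N + k) \<omega>)}"
  have q: "ex (N + (N + k)) (\<lambda>x. of_bool (Q (take (N + k) (drop i x)))) = q" if "i < N" for i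
  proof -
    have "q = prob {\<omega> \<in> space P. Q (block X i (N + k) \<omega>)}" unfolding q_def prob_block ..
    also have "\<dots> = prob {\<omega> \<in> space P. Q (take (N + k) (drop i (initial_word X (N + (N + k)) \<omega>)))}"
      using that by (simp add: take_drop_initial_word)
    also have "\<dots> = ex (N + (N + k)) (\<lambda>x. of_bool (Q (take (N + k) (drop i x))))"
      by (rule prob_initial_word)
    finally show ?thesis by simp
  qed
  \<comment> \<open>All \<open>N\<close> starting times have the same probability \<open>q\<close>,
    so the left side is the expected number of them without a return.\<close>
  have "real N * q = ex (N + (N + k)) (\<lambda>x. \<Sum>i<N. of_bool (Q (take (N + k) (drop i x))))"
  proof -
    have "(\<Sum>i<N. ex (N + (N + k)) (\<lambda>x. of_bool (Q (take (N + k) (drop i x))))) = (\<Sum>i<N. q)"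
      by (rule sum.cong[OF refl], rule q) simp
    then show ?thesis unfolding ex_sum by simp
  qed
  also have "\<dots> \<le> ex (N + (N + k)) (\<lambda>_. real k)"
  proof (rule ex_mono)
    fix x
    define I where "I = {i \<in> {..<N}. Q (take (N + k) (drop i x))}"
    have close: "j < i + k" if ij: "i \<in> I" "j \<in> I" "i \<le> j" for i j
    proof (rule ccontr)
      assume "\<not> j < i + k"
      then have r: "j - i \<in> {k..N}" using ij by (auto simp: I_def)
      have "take k (drop (j - i) (take (N + k) (drop i x))) = take k (drop j x)"
      proof -
        have "k \<le> N + k - (j - i)" using r by auto
        moreover have "drop (j - i) (drop i x) = drop j x" using ij(3) by simp
        ultimately show ?thesis by (simp only: drop_take take_take min_absorb1)
      qed
      moreover have "take k (take (N + k) (drop j x)) = take k (drop j x)" by simp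
      ultimately show False using ij r by (auto simp: I_def Q_def)
    qed
    have "card I \<le> k"
    proof (cases "I = {}")
      case False
      have fin: "finite I" by (simp add: I_def)
      have "I \<subseteq> {Min I..<Min I + k}"
        using close[OF Min_in[OF fin False]] fin by auto
      then have "card I \<le> card {Min I..<Min I + k}" by (intro card_mono) auto
      then show ?thesis by simp
    qed simp
    moreover have "(\<Sum>i<N. of_bool (Q (take (N + k) (drop i x)))) = (\<Sum>i\<in>I. 1 :: real)"
      unfolding I_def by (rule sum.mono_neutral_cong_right) auto
    ultimately show "(\<Sum>i<N. of_bool (Q (take (N + k) (drop i x)))) \<le> real k" by simp
  qed
  also have "\<dots> = real k" by (rule ex_const)
  finally have "q \<le> real k / real N" using N by (simp add: field_simps)
  moreover have "{\<omega> \<in> space P. Q (block X 0 (N + k) \<omega>)}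
      = {\<omega> \<in> space P. initial_word X k \<omega> = w \<and> (\<forall>r\<in>{k..N}. block X r k \<omega> \<noteq> w)}"
    unfolding Q_def initial_word_eq_block[symmetric]
    by (auto simp: take_drop_initial_word take_initial_word)
  ultimately show ?thesis by (simp add: q_def)
qed

text \<open>Words of probability at least \<open>exp (- k * (h + \<epsilon>))\<close> are few
  because their masses sum to at most 1, and each fails to return by time \<open>N k\<close> with
  probability at most \<open>k / N k\<close>. By \<open>ln_p_rate\<close> the initial block is
  eventually one of them.\<close>

lemma early_repeat:
  assumes h': "cond_entropy M < h'"
  shows "AE \<omega> in P. \<forall>\<^sub>F k in sequentially. \<exists>r\<ge>k.
    r \<le> nat \<lceil>exp (real k * h')\<rceil> \<and> block X r k \<omega> = initial_word X k \<omega>"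
proof -
  define h where "h = cond_entropy M"
  \<comment> \<open>One \<epsilon> is spent on the number of typical words; the second leaves the
    summable bound \<open>k * exp (- \<epsilon> * k)\<close>.\<close>
  define \<epsilon> where "\<epsilon> = (h' - h) / 2"
  have \<epsilon>: "0 < \<epsilon>" "h' = h + 2 * \<epsilon>" using h' by (auto simp: \<epsilon>_def h_def field_simps)
  define N where "N k = nat \<lceil>exp (real k * h')\<rceil>" for k
  have N: "exp (real k * h') \<le> real (N k)" "0 < N k" for k
    by (auto simp: N_def real_nat_ceiling_ge)
  define T where "T k = {w \<in> words A k. exp (- real k * (h + \<epsilon>)) \<le> p w}" for k
  have T: "finite (T k)" for k by (simp add: T_def)
  have card_T: "real (card (T k)) \<le> exp (real k * (h + \<epsilon>))" for k
  proof -
    have "real (card (T k)) * exp (- real k * (h + \<epsilon>)) = (\<Sum>w\<in>T k. exp (- real k * (h + \<epsilon>)))" by simp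
    also have "\<dots> \<le> (\<Sum>w\<in>T k. p w)" by (rule sum_mono) (simp add: T_def)
    also have "\<dots> \<le> (\<Sum>w\<in>words A k. p w)" by (rule sum_mono2) (auto simp: T_def p_nonneg)
    finally have "real (card (T k)) * exp (- real k * (h + \<epsilon>)) \<le> 1" by (simp add: sum_p_words)
    from mult_right_mono[OF this, of "exp (real k * (h + \<epsilon>))"] show ?thesis
      by (simp add: mult.assoc flip: exp_add)
  qed
  define D where "D k w = {\<omega> \<in> space P. initial_word X k \<omega> = w \<and> (\<forall>r\<in>{k..N k}. block X r k \<omega> \<noteq> w)}" for k w
  have D_events: "D k w \<in> events" for k w
    unfolding D_def
    by (intro sets.sets_Collect_conj sets.sets_Collect_finite_All sets_initial_word sets_block) auto
  define E where "E k = (\<Union>w\<in>T k. D k w)" for k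
  have E_events: "E k \<in> events" for k unfolding E_def using D_events T by blast
  have E_le: "prob (E k) \<le> real k * exp (- \<epsilon> * real k)" if k: "0 < k" for k
  proof -
    have "prob (E k) \<le> (\<Sum>w\<in>T k. prob (D k w))"
      unfolding E_def using D_events T by (intro finite_measure_subadditive_finite) auto
    also have "\<dots> \<le> (\<Sum>w\<in>T k. real k / real (N k))"
      unfolding D_def using k N by (intro sum_mono prob_no_return_le) (auto simp: T_def)
    also have "\<dots> = real (card (T k)) * (real k / real (N k))" by simp
    also have "\<dots> \<le> exp (real k * (h + \<epsilon>)) * (real k / exp (real k * h'))"
      using card_T N(1) N(2)[of k] by (intro mult_mono divide_left_mono) auto
    also have "\<dots> = real k * (exp (real k * (h + \<epsilon>)) / exp (real k * h'))" by simp
    also have "exp (real k * (h + \<epsilon>)) / exp (real k * h') = exp (- \<epsilon> * real k)"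
      unfolding exp_diff[symmetric] \<epsilon>(2) by (simp add: algebra_simps)
    finally show ?thesis .
  qed
  have "summable (\<lambda>k. prob (E k))"
  proof (rule summable_comparison_test_ev)
    show "summable (\<lambda>k. real k powr (-2))" by (simp add: summable_real_powr_iff)
    have "\<forall>\<^sub>F k in sequentially. real k * exp (- \<epsilon> * real k) \<le> real k powr (-2)"
      using \<epsilon>(1) by real_asymp
    then show "\<forall>\<^sub>F k in sequentially. norm (prob (E k)) \<le> real k powr (-2)"
      using eventually_gt_at_top[of 0]
    proof eventually_elim
      case (elim k)
      show ?case using order.trans[OF E_le[OF elim(2)] elim(1)] by simp
    qed
  qed
  then have "AE \<omega> in P. \<forall>\<^sub>F k in sequentially. \<omega> \<in> space P - E k"
    by (intro borel_cantelli_AE1 E_events) (auto simp: emeasure_eq_measure)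
  then show ?thesis
    using ln_p_rate[OF less_numeral_extra(1)] AE_p_pos AE_space
  proof eventually_elim
    case (elim \<omega>)
    note pos = elim(3) and \<omega> = elim(4)
    have "\<forall>\<^sub>F k in sequentially. real k powr (3/4) \<le> \<epsilon> * real k" using \<epsilon>(1) by real_asymp
    with elim(1,2) show ?case
    proof eventually_elim
      case (elim k)
      have "- real k * (h + \<epsilon>) \<le> ln (p (initial_word X k \<omega>))"
        using elim(2,3) by (simp add: h_def algebra_simps)
      then have "exp (- real k * (h + \<epsilon>)) \<le> p (initial_word X k \<omega>)"
        using pos[rule_format, of k] by (simp only: ln_ge_iff)
      then have "initial_word X k \<omega> \<in> T k" using set_initial_word[OF \<omega>] by (simp add: T_def)
      then have "\<omega> \<notin> D k (initial_word X k \<omega>)" using elim(1) by (auto simp: E_def)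
      then show ?case using \<omega> by (auto simp: D_def N_def)
    qed
  qed
qed

text \<open>Apply \<open>early_repeat\<close> to the length \<open>k\<close>, the integer part of
  \<open>ln n / g\<close>: the return comes before about \<open>exp (k * h')\<close>, hence inside
  the first \<open>n\<close> letters.\<close>

lemma repeat_length_lower:
  assumes "cond_entropy M < g"
  shows "AE \<omega> in P. \<forall>\<^sub>F n in sequentially. ln (real n) / g - 1 \<le> real (repeat_length (initial_word X n \<omega>))"
proof -
  \<comment> \<open>A value strictly between entropy and \<open>g\<close> makes the return time at
    most \<open>n powr q + 1\<close> with \<open>q < 1\<close>, leaving room for the block
    itself.\<close>
  define h' where "h' = (cond_entropy M + g) / 2"
  have h': "cond_entropy M < h'" "h' < g" "0 < h'" "0 < g"
    using assms cond_entropy_nonneg[of M] by (auto simp: h'_def)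
  define q where "q = h' / g"
  have q: "0 < q" "q < 1" using h' by (auto simp: q_def)
  show ?thesis
    using early_repeat[OF h'(1)]
  proof eventually_elim
    case (elim \<omega>)
    then obtain K where K: "\<And>k. K \<le> k \<Longrightarrow> \<exists>r\<ge>k. r \<le> nat \<lceil>exp (real k * h')\<rceil> \<and> block X r k \<omega> = initial_word X k \<omega>"
      by (auto simp: eventually_sequentially)
    have "\<forall>\<^sub>F n in sequentially. real K + 1 \<le> ln (real n) / g" using h' by real_asymp
    moreover have "\<forall>\<^sub>F n in sequentially. real n powr q + 1 + ln (real n) / g \<le> real n"
      using h' q by real_asymp
    ultimately show ?case using eventually_gt_at_top[of 0]
    proof eventually_elim
      case (elim n)
      define k where "k = nat \<lfloor>ln (real n) / g\<rfloor>"
      have k: "real k \<le> ln (real n) / g" "ln (real n) / g - 1 \<le> real k" "K \<le> k"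
        using elim(1) unfolding k_def by linarith+
      obtain r where r: "k \<le> r" "r \<le> nat \<lceil>exp (real k * h')\<rceil>" "block X r k \<omega> = initial_word X k \<omega>"
        using K[OF k(3)] by blast
      have "real r \<le> exp (real k * h') + 1"
      proof -
        have "real (nat \<lceil>exp (real k * h')\<rceil>) \<le> exp (real k * h') + 1"
          using of_int_ceiling_le_add_one[of "exp (real k * h')"] by simp
        then show ?thesis using r(2) by linarith
      qed
      also have "real k * h' \<le> ln (real n) / g * h'" using k(1) h' by (intro mult_right_mono) auto
      then have "exp (real k * h') \<le> real n powr q"
        using elim(3) by (simp add: powr_def q_def mult_ac)
      finally have "real (r + k) \<le> real n" using k(1) elim(2) by simp
      then have "r + k \<le> n" by linarith
      then have "k \<le> repeat_length (initial_word X n \<omega>)"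
        using r by (intro repeat_length_ge[of k r]) (auto simp: take_drop_initial_word take_initial_word)
      then show ?case using k(2) by linarith
    qed
  qed
qed

text \<open>Inserting the lower bound on the repeat length yields a bound that tends to
  \<open>g\<close>, which lies \<epsilon>/2 below the target.\<close>

lemma entropy_threshold_upper:
  assumes "0 < \<epsilon>"
  shows "AE \<omega> in P. \<forall>\<^sub>F n in sequentially.
    entropy_threshold (initial_word X n \<omega>) \<le> ereal (cond_entropy M + \<epsilon>)"
proof -
  define g where "g = cond_entropy M + \<epsilon> / 2"
  have g: "cond_entropy M < g" "0 < g" using assms cond_entropy_nonneg[of M] by (auto simp: g_def)
  have "(\<lambda>n. ln (real n) / (ln (real n) / g - 1) + 2 * ln (real n) powr (- 1 / 4)) \<longlonglongrightarrow> g"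
    using g by real_asymp
  then have lim: "\<forall>\<^sub>F n in sequentially.
      ln (real n) / (ln (real n) / g - 1) + 2 * ln (real n) powr (- 1 / 4) < cond_entropy M + \<epsilon>"
    using assms by (intro order_tendstoD(2)) (auto simp: g_def)
  have pos: "\<forall>\<^sub>F n in sequentially. 0 < ln (real n) / g - 1" using g by real_asymp
  show ?thesis
    using repeat_length_lower[OF g(1)]
  proof eventually_elim
    case (elim \<omega>)
    from elim lim pos eventually_ge_at_top[of 2] show ?case
    proof eventually_elim
      case (elim n)
      let ?l = "repeat_length (initial_word X n \<omega>)"
      \<comment> \<open>A positive repeat length rules out the infinite value of the
        threshold.\<close>
      have "0 < real ?l" using elim(1,3) by linarith
      moreover have "ln (real n) / real ?l \<le> ln (real n) / (ln (real n) / g - 1)"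
        using elim by (intro divide_left_mono) (auto intro!: mult_pos_pos)
      ultimately show ?case using elim(2) by (simp add: entropy_threshold_def)
    qed
  qed
qed

section \<open>Consistency of the estimator\<close>

lemma order_estimate_tendsto:
  assumes minimal: "\<And>k. k < M \<Longrightarrow> \<not> memory_at_most P A X k"
  shows "AE \<omega> in P. (\<lambda>n. order_estimate A (initial_word X n \<omega>)) \<longlonglongrightarrow> M"
proof -
  \<comment> \<open>Orders below \<open>M\<close> are rejected: minimality supplies a word
    witnessing that memory \<open>k\<close> is too short, so the limit of the empirical entropy
    exceeds that of the threshold.\<close>
  have above: "AE \<omega> in P. \<forall>k\<in>{..<M}. \<forall>\<^sub>F n in sequentially.
      entropy_threshold (initial_word X n \<omega>) < ereal (emp_entropy A k (initial_word X n \<omega>))"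
  proof (rule AE_finite_allI)
    fix k assume "k \<in> {..<M}"
    then have k: "k < M" by simp
    have "cond_entropy M < cond_entropy k"
      using minimal[OF k] k unfolding memory_at_most_def next_prob_eq_nx
      by (auto intro: cond_entropy_less)
    define \<epsilon> where "\<epsilon> = (cond_entropy k - cond_entropy M) / 2"
    have \<epsilon>: "0 < \<epsilon>" "cond_entropy M + \<epsilon> < cond_entropy k"
      using \<open>cond_entropy M < cond_entropy k\<close> by (auto simp: \<epsilon>_def field_simps)
    show "AE \<omega> in P. \<forall>\<^sub>F n in sequentially.
        entropy_threshold (initial_word X n \<omega>) < ereal (emp_entropy A k (initial_word X n \<omega>))"
      using entropy_threshold_upper[OF \<epsilon>(1)] emp_entropy_tendsto[of k]
    proof eventually_elim
      case (elim \<omega>)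
      from elim(1) order_tendstoD(1)[OF elim(2) \<epsilon>(2)] show ?case
        by eventually_elim (auto elim: order.strict_trans1)
    qed
  qed simp
  \<comment> \<open>Order \<open>M\<close> is accepted, because its empirical entropy and the
    threshold are separated by the same bound. With finitely many smaller orders rejected, the
    estimate is eventually equal to \<open>M\<close>.\<close>
  show ?thesis
    using above emp_entropy_upper entropy_threshold_lower
  proof eventually_elim
    case (elim \<omega>)
    have "\<forall>\<^sub>F n in sequentially. \<forall>k\<in>{..<M}.
        entropy_threshold (initial_word X n \<omega>) < ereal (emp_entropy A k (initial_word X n \<omega>))"
      using elim(1) by (intro eventually_ball_finite) auto
    with elim(2,3) eventually_gt_at_top[of M]
    have "\<forall>\<^sub>F n in sequentially. order_estimate A (initial_word X n \<omega>) = M"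
    proof eventually_elim
      case (elim n)
      have "ereal (emp_entropy A M (initial_word X n \<omega>)) \<le> ereal (cond_entropy M + ln (real n) powr (- 1 / 4))"
        using elim(1) by simp
      also have "\<dots> \<le> entropy_threshold (initial_word X n \<omega>)" using elim(2) by simp
      finally show ?case
        unfolding order_estimate_def using elim(3,4)
        by (intro Least_equality) (auto simp: not_less[symmetric])
    qed
    then show ?case by (rule tendsto_eventually)
  qed
qed

end

section \<open>Independence and order zero\<close>

context finite_process
begin

lemma prob_X_eq:
  assumes "b \<in> A"
  shows "prob (X i -` {b} \<inter> space P) = p [b]"
proof -
  have "X i -` {b} \<inter> space P = {\<omega> \<in> space P. block X i (length [b]) \<omega> = [b]}"
    by (auto simp: block_def)
  then show ?thesis by (simp only: prob_block_eq)
qed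

text \<open>Order 0 is defined by independence, whereas the main argument speaks of memory; the
  product form of the block probabilities links the two.\<close>

lemma memory_at_most_0_iff:
  "memory_at_most P A X 0 \<longleftrightarrow> (\<forall>w b. set w \<subseteq> A \<longrightarrow> b \<in> A \<longrightarrow> p (w @ [b]) = p w * p [b])"
  (is "?L \<longleftrightarrow> ?R")
proof
  assume L: ?L
  show ?R
  proof (intro allI impI)
    fix w b assume w: "set w \<subseteq> A" "b \<in> A"
    have "nx w b = nx [] b" if "0 < p w"
      using L w that unfolding memory_at_most_def next_prob_eq_nx by fastforce
    then show "p (w @ [b]) = p w * p [b]"
      using p_mult_nx[OF w] p_nonneg[of w] by (cases "p w = 0") (auto simp: nx_def p_Nil)
  qed
next
  assume R: ?R
  then show ?L
    unfolding memory_at_most_def next_prob_eq_nx by (auto simp: nx_def p_Nil)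
qed

lemma iid_imp_memory_at_most_0:
  assumes "iid_process P A X"
  shows "memory_at_most P A X 0"
proof -
  have indep: "indep_vars (\<lambda>_. count_space A) X UNIV"
    using assms by (simp add: iid_process_def)
  have prod: "p w = (\<Prod>b\<leftarrow>w. p [b])" if w: "set w \<subseteq> A" for w
  proof (cases "w = []")
    case True
    then show ?thesis by (simp add: p_Nil)
  next
    case False
    have wi: "w ! i \<in> A" if "i < length w" for i using that w by auto
    have "p w = prob {\<omega> \<in> space P. initial_word X (length w) \<omega> = w}"
      by (simp add: block_prob_def)
    also have "{\<omega> \<in> space P. initial_word X (length w) \<omega> = w}
        = (\<Inter>i\<in>{..<length w}. X i -` {w ! i} \<inter> space P)"
    proof -
      have "initial_word X (length w) \<omega> = w \<longleftrightarrow> (\<forall>i<length w. X i \<omega> = w ! i)" for \<omega>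
        unfolding list_eq_iff_nth_eq by (simp add: initial_word_def)
      then show ?thesis using False by auto
    qed
    also have "prob \<dots> = (\<Prod>i<length w. prob (X i -` {w ! i} \<inter> space P))"
      using False wi by (intro indep_varsD[OF indep]) auto
    also have "\<dots> = (\<Prod>i<length w. p [w ! i])"
      using wi by (intro prod.cong) (auto simp: prob_X_eq)
    also have "\<dots> = (\<Prod>b\<leftarrow>w. p [b])"
      by (simp add: prod.list_conv_set_nth atLeast0LessThan)
    finally show ?thesis .
  qed
  show ?thesis
    unfolding memory_at_most_0_iff
  proof (intro allI impI)
    fix w b assume "set w \<subseteq> A" "b \<in> A"
    then show "p (w @ [b]) = p w * p [b]"
      using prod[of "w @ [b]"] prod[of w] by simp
  qed
qed

text \<open>Block probabilities are products of the letter probabilities, so product events on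
  initial segments factor. Stationarity gives identical distributions.\<close>

lemma memory_at_most_0_imp_iid:
  assumes "memory_at_most P A X 0"
  shows "iid_process P A X"
proof -
  have p_snoc: "p (w @ [b]) = p w * p [b]" if "set w \<subseteq> A" "b \<in> A" for w b
    using assms that by (simp add: memory_at_most_0_iff)
  define s where "s B = (\<Sum>b\<in>A. of_bool (b \<in> B) * p [b])" for B
  have prob_s: "prob (X i -` B \<inter> space P) = s B" for i B
  proof -
    have "X i -` B \<inter> space P = {\<omega> \<in> space P. hd (block X i 1 \<omega>) \<in> B}"
      by (auto simp: block_def)
    also have "prob \<dots> = (\<Sum>w | w \<in> words A 1 \<and> hd w \<in> B. p w)" by (rule prob_block)
    also have "\<dots> = (\<Sum>w\<in>words A 1. of_bool (hd w \<in> B) * p w)"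
      by (rule sum.mono_neutral_cong_left) auto
    finally show ?thesis by (simp only: sum_words_1 s_def list.sel)
  qed
  have factor: "(\<Sum>w\<in>words A n. (\<Prod>i<n. of_bool (w ! i \<in> B i)) * p w) = (\<Prod>i<n. s (B i))" for n B
  proof (induction n)
    case (Suc n)
    have "(\<Sum>w\<in>words A (Suc n). (\<Prod>i<Suc n. of_bool (w ! i \<in> B i)) * p w)
        = (\<Sum>w\<in>words A n. \<Sum>b\<in>A. ((\<Prod>i<n. of_bool (w ! i \<in> B i)) * p w) * (of_bool (b \<in> B n) * p [b]))"
      unfolding sum_words_snoc
      by (intro sum.cong refl) (auto simp: p_snoc nth_append mult_ac)
    also have "\<dots> = (\<Prod>i<n. s (B i)) * s (B n)"
      unfolding Suc[symmetric] by (simp only: s_def sum_product)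
    finally show ?case by simp
  qed (simp add: p_Nil)
  have "indep_vars (\<lambda>_. count_space A) X UNIV"
    unfolding indep_vars_def2
  proof (intro conjI ballI X_measurable indep_setsI)
    fix D and J :: "nat set"
    assume J: "J \<noteq> {}" "finite J" and D: "\<forall>j\<in>J. D j \<in> {X j -` A' \<inter> space P |A'. A' \<in> sets (count_space A)}"
    then obtain B where B: "\<And>j. j \<in> J \<Longrightarrow> D j = X j -` B j \<inter> space P"
      by (auto simp: Bex_def) metis
    \<comment> \<open>Padding with the sure event extends an arbitrary finite index set to an
      initial segment.\<close>
    define B' where "B' j = (if j \<in> J then B j else UNIV)" for j
    define n where "n = Suc (Max J)"
    have Jn: "j < n" if "j \<in> J" for j using J that by (simp add: n_def less_Suc_eq_le)
    have "(\<Inter>j\<in>J. D j) = {\<omega> \<in> space P. \<forall>i<n. initial_word X n \<omega> ! i \<in> B' i}"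
      using J(1) B Jn by (auto simp: B'_def initial_word_def)
    then have "prob (\<Inter>j\<in>J. D j) = (\<Sum>w\<in>words A n. p w * of_bool (\<forall>i<n. w ! i \<in> B' i))"
      using prob_initial_word[of "\<lambda>w. \<forall>i<n. w ! i \<in> B' i" n] by (simp add: ex_def)
    also have "\<dots> = (\<Sum>w\<in>words A n. (\<Prod>i<n. of_bool (w ! i \<in> B' i)) * p w)"
      by (rule sum.cong) auto
    also have "\<dots> = (\<Prod>i<n. s (B' i))" by (rule factor)
    also have "\<dots> = (\<Prod>j\<in>J. s (B j))"
    proof (rule prod.mono_neutral_cong_right)
      have "s UNIV = 1" using prob_s[of 0 UNIV] prob_space by simp
      then show "\<forall>i\<in>{..<n} - J. s (B' i) = 1" by (simp add: B'_def)
    qed (use Jn in \<open>auto simp: B'_def\<close>)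
    also have "\<dots> = (\<Prod>j\<in>J. prob (D j))"
      by (rule prod.cong) (simp_all add: B prob_s)
    finally show "prob (\<Inter>j\<in>J. D j) = (\<Prod>j\<in>J. prob (D j))" .
  next
    fix i show "{X i -` A' \<inter> space P |A'. A' \<in> sets (count_space A)} \<subseteq> events"
      using measurable_sets[OF X_measurable[of i]] by auto
  qed
  moreover have "distr P (count_space A) (X i) = distr P (count_space A) (X 0)" for i
  proof (rule measure_eqI)
    fix B assume "B \<in> sets (distr P (count_space A) (X i))"
    then show "emeasure (distr P (count_space A) (X i)) B = emeasure (distr P (count_space A) (X 0)) B"
      using X_measurable by (simp add: emeasure_distr emeasure_eq_measure prob_s)
  qed simp
  ultimately show ?thesis by (simp add: iid_process_def)
qed

end

theorem theorem1:
  fixes A :: "'a set" and P :: "'w measure" and X :: "nat \<Rightarrow> 'w \<Rightarrow> 'a" and M :: nat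
  assumes "finite A"
    and "prob_space P"
    and "\<And>i. X i \<in> measurable P (count_space A)"
    and "stationary_process P A X"
    and "ergodic_process P A X"
    and "markov_of_order P A X M"
  shows "AE \<omega> in P. (\<lambda>n. order_estimate A (initial_word X n \<omega>)) \<longlonglongrightarrow> M"
proof -
  interpret prob_space P by (rule assms(2))
  interpret finite_process P A X
    by unfold_locales (use assms in auto)
  have "memory_at_most P A X M"
    using assms(6) iid_imp_memory_at_most_0 by (auto simp: markov_of_order_def split: if_splits)
  then interpret ergodic_markov_process P A X M
    by unfold_locales (use assms in auto)
  show ?thesis
  proof (rule order_estimate_tendsto)
    \<comment> \<open>For \<open>M > 0\<close> the definition of order excludes the memories between
      0 and \<open>M\<close> directly; memory 0 is excluded because it would make the process
      i.i.d.\<close>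
    fix k assume "k < M"
    then show "\<not> memory_at_most P A X k"
      using assms(6) memory_at_most_0_imp_iid
      by (cases "k = 0") (auto simp: markov_of_order_def split: if_splits)
  qed
qed

end
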